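(* Fix $\theta>0$ and let $\sigma$ be drawn from the Ewens measure $\mathbb{P}_{\theta,n}$ on $\mathfrak{S}_n$. Then for all real $x$, \[\lim_{n\to\infty}\mathbb{P}_{\theta,n}\!\left(\frac{\log\mathsf{invol}(\sigma)-\mu_n}{\sigma_n}\le x\right)=\Phi(x),\] where $\mu_n=\sum_{k=1}^n\frac{\theta\log k}{k}$, $\sigma_n^2=\sum_{k=1}^n\frac{\theta\log^2 k}{k}$, and $\Phi(x)=\frac{1}{\sqrt{2\pi}}\int_{-\infty}^x e^{-t^2/2}\,dt$.
   Context: $\mathsf{invol}(\sigma)$ is the number of ordered pairs $(\tau_1,\tau_2)$ of involutions in $\mathfrak{S}_n$ with $\sigma=\tau_2\circ\tau_1$. For $\theta>0$, the Ewens measure on $\mathfrak{S}_n$ is $\mathbb{P}_{\theta,n}(\sigma=\sigma_0)=\theta^{K(\sigma_0)}/\theta^{(n)}$, where $K(\sigma_0)$ is the number of cycles of $\sigma_0$ and $\theta^{(n)}=\theta(\theta+1)\cdots(\theta+n-1)$. *)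

theory Defs
  imports "HOL-Analysis.Analysis" "HOL-Combinatorics.Combinatorics"
begin

definition involutions :: "nat \<Rightarrow> (nat \<Rightarrow> nat) set" where
  "involutions n = {\<tau>. \<tau> permutes {1..n} \<and> \<tau> \<circ> \<tau> = id}"

definition invol :: "nat \<Rightarrow> (nat \<Rightarrow> nat) \<Rightarrow> nat" where
  "invol n \<sigma> = card {(\<tau>1, \<tau>2). \<tau>1 \<in> involutions n \<and> \<tau>2 \<in> involutions n \<and> \<sigma> = \<tau>2 \<circ> \<tau>1}"

definition num_cycles :: "nat \<Rightarrow> (nat \<Rightarrow> nat) \<Rightarrow> nat" where
  "num_cycles n \<sigma> = card ((\<lambda>x. orbit \<sigma> x) ` {1..n})"

definition ewens_prob :: "real \<Rightarrow> nat \<Rightarrow> ((nat \<Rightarrow> nat) \<Rightarrow> bool) \<Rightarrow> real" where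
  "ewens_prob \<theta> n P =
     (\<Sum>\<sigma>\<in>{\<sigma>. \<sigma> permutes {1..n} \<and> P \<sigma>}. \<theta> ^ num_cycles n \<sigma>) / pochhammer \<theta> n"

definition Phi :: "real \<Rightarrow> real" where
  "Phi x = (LBINT t:{..x}. exp (- (t\<^sup>2) / 2)) / sqrt (2 * pi)"

definition ewens_mu :: "real \<Rightarrow> nat \<Rightarrow> real" where
  "ewens_mu \<theta> n = (\<Sum>k=1..n. \<theta> * ln (real k) / real k)"

definition ewens_sigma :: "real \<Rightarrow> nat \<Rightarrow> real" where
  "ewens_sigma \<theta> n = sqrt (\<Sum>k=1..n. \<theta> * (ln (real k))\<^sup>2 / real k)"

end

theory Submission
  imports Defs "HOL-Probability.Probability" "HOL-Real_Asymp.Real_Asymp"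
begin

text \<open>
  An involution \<open>\<tau>\<close> for which \<open>\<sigma> \<circ> \<tau>\<close> is an involution reverses \<open>\<sigma>\<close>, so it is determined by the images of
  the cycle minima. Sending each minimum anywhere in its own cycle gives such a \<open>\<tau>\<close>, and the minimum
  of a cycle of length \<open>l\<close> can only go to one of the at most \<open>K\<close> cycles of length \<open>l\<close>, where \<open>K\<close> is the
  number of cycles. Hence \<open>ln invol\<close> is the sum of the logarithms of the cycle lengths up to an error of
  at most \<open>K ln K\<close>, which is of order \<open>ln n ln (ln n)\<close> in mean.

  Insert the elements \<open>1, 2, \<dots>\<close> one at a time (Chinese restaurant process). The events ``\<open>i\<close> is the
  minimum of its cycle'' are then independent with probabilities \<open>\<theta> / (\<theta> + i - 1)\<close>, and a cycle with
  minimum \<open>i\<close> has length about \<open>n / i\<close>, with an error in the logarithm that is bounded in mean. So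
  \<open>ln invol\<close> differs from a sum of independent variables, \<open>ln (n / i)\<close> times a Bernoulli variable, by
  \<open>O(ln n ln (ln n))\<close> in mean, whereas the standard deviation is of order \<open>(ln n) powr (3/2)\<close>. The
  characteristic function of the sum is explicit, and Levy's continuity theorem concludes.
\<close>

section \<open>Involutions and cycle minima\<close>

text \<open>Each cycle is represented by its least element, so sums over cycles run over a subset of
  {1..n}. Taking the least element matters: inserting a larger element into an existing cycle does
  not change its representative.\<close>

definition cycle_mins :: "nat \<Rightarrow> (nat \<Rightarrow> nat) \<Rightarrow> nat set" where
  "cycle_mins n \<sigma> = {i \<in> {1..n}. \<forall>j\<in>orbit \<sigma> i. i \<le> j}"

lemma finite_cycle_mins [simp]: "finite (cycle_mins n \<sigma>)"
  by (simp add: cycle_mins_def)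

lemma permutes_imp_permutation: "\<sigma> permutes {1..n::nat} \<Longrightarrow> permutation \<sigma>"
  by (auto simp: permutation_permutes)

lemma orbit_eq_of_mem:
  assumes "permutation \<sigma>" "y \<in> orbit \<sigma> x"
  shows "orbit \<sigma> y = orbit \<sigma> x"
  using cyclic_on_orbit'[OF assms(1)] assms(2) by (rule orbit_cyclic_eq3)

lemma finite_orbit_permutation: "permutation \<sigma> \<Longrightarrow> finite (orbit \<sigma> x)"
  by (intro finite_orbit permutation_self_in_orbit)

lemma card_orbit_pos: "permutation \<sigma> \<Longrightarrow> 0 < card (orbit \<sigma> x)"
  by (simp add: card_gt_0_iff finite_orbit_permutation orbit_nonempty)

lemma cycle_mins_unique:
  assumes "permutation \<sigma>" "i \<in> cycle_mins n \<sigma>" "j \<in> cycle_mins n \<sigma>"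
    and "x \<in> orbit \<sigma> i" "x \<in> orbit \<sigma> j"
  shows "i = j"
proof -
  have "orbit \<sigma> i = orbit \<sigma> j"
    using orbit_eq_of_mem[OF assms(1)] assms(4,5) by metis
  then have "i \<in> orbit \<sigma> j" "j \<in> orbit \<sigma> i"
    using permutation_self_in_orbit[OF assms(1)] by auto
  then show ?thesis
    using assms(2,3) by (force simp: cycle_mins_def)
qed

lemma cycle_mins_cover:
  assumes \<sigma>: "\<sigma> permutes {1..n}" and x: "x \<in> {1..n}"
  obtains i where "i \<in> cycle_mins n \<sigma>" "x \<in> orbit \<sigma> i" "orbit \<sigma> i = orbit \<sigma> x"
proof -
  have p: "permutation \<sigma>" using permutes_imp_permutation[OF \<sigma>] .
  define i where "i = Min (orbit \<sigma> x)"
  have i: "i \<in> orbit \<sigma> x" unfolding i_def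
    using finite_orbit_permutation[OF p] orbit_nonempty by (intro Min_in)
  have eq: "orbit \<sigma> i = orbit \<sigma> x" using orbit_eq_of_mem[OF p i] .
  have "i \<in> {1..n}" using permutes_orbit_subset[OF \<sigma> x] i by auto
  moreover have "\<forall>j\<in>orbit \<sigma> i. i \<le> j" unfolding eq unfolding i_def
    using finite_orbit_permutation[OF p] by auto
  ultimately have "i \<in> cycle_mins n \<sigma>" by (simp add: cycle_mins_def)
  then show ?thesis using that eq permutation_self_in_orbit[OF p] by metis
qed

lemma num_cycles_eq:
  assumes \<sigma>: "\<sigma> permutes {1..n}"
  shows "num_cycles n \<sigma> = card (cycle_mins n \<sigma>)"
proof -
  have p: "permutation \<sigma>" using permutes_imp_permutation[OF \<sigma>] .
  have "orbit \<sigma> ` {1..n} = orbit \<sigma> ` cycle_mins n \<sigma>"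
  proof
    show "orbit \<sigma> ` {1..n} \<subseteq> orbit \<sigma> ` cycle_mins n \<sigma>"
      using cycle_mins_cover[OF \<sigma>] by (metis image_eqI image_subsetI)
  qed (auto simp: cycle_mins_def)
  moreover have "inj_on (orbit \<sigma>) (cycle_mins n \<sigma>)"
    using cycle_mins_unique[OF p] permutation_self_in_orbit[OF p] by (metis inj_onI)
  ultimately show ?thesis by (simp add: num_cycles_def card_image)
qed

lemma card_cycle_mins_pos:
  assumes "\<sigma> permutes {1..n}" "n \<ge> 1"
  shows "card (cycle_mins n \<sigma>) \<ge> 1"
  using cycle_mins_cover[OF assms(1), of 1] assms(2)
  by (metis One_nat_def Suc_leI atLeastAtMost_iff card_gt_0_iff empty_iff finite_cycle_mins le_refl)

section \<open>Counting factorisations through involutions that reverse the permutation\<close>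

definition reversers :: "nat \<Rightarrow> (nat \<Rightarrow> nat) \<Rightarrow> (nat \<Rightarrow> nat) set" where
  "reversers n \<sigma> = {\<tau> \<in> involutions n. \<sigma> \<circ> \<tau> \<in> involutions n}"

text \<open>In a factorisation the second involution is \<open>\<sigma> \<circ> \<tau>1\<close>,
  because \<open>\<tau>1\<close> is its own inverse. Hence only the first factor has to be
  counted.\<close>

lemma invol_eq_card_reversers: "invol n \<sigma> = card (reversers n \<sigma>)"
proof -
  have "{(\<tau>1, \<tau>2). \<tau>1 \<in> involutions n \<and> \<tau>2 \<in> involutions n \<and> \<sigma> = \<tau>2 \<circ> \<tau>1}
      = (\<lambda>\<tau>. (\<tau>, \<sigma> \<circ> \<tau>)) ` reversers n \<sigma>" (is "?A = ?B")
  proof (intro set_eqI, safe)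
    fix \<tau>1 \<tau>2 assume *: "\<tau>1 \<in> involutions n" "\<tau>2 \<in> involutions n" "\<sigma> = \<tau>2 \<circ> \<tau>1"
    then have "\<tau>2 = \<sigma> \<circ> \<tau>1"
      by (simp add: involutions_def comp_assoc)
    then show "(\<tau>1, \<tau>2) \<in> (\<lambda>\<tau>. (\<tau>, (\<tau>2 \<circ> \<tau>1) \<circ> \<tau>)) ` reversers n (\<tau>2 \<circ> \<tau>1)"
      using * by (auto simp: reversers_def)
  next
    fix \<tau> assume "\<tau> \<in> reversers n \<sigma>"
    then show "\<tau> \<in> involutions n" "\<sigma> \<circ> \<tau> \<in> involutions n" "\<sigma> = \<sigma> \<circ> \<tau> \<circ> \<tau>"
      by (auto simp: reversers_def involutions_def comp_assoc)
  qed
  moreover have "inj_on (\<lambda>\<tau>. (\<tau>, \<sigma> \<circ> \<tau>)) (reversers n \<sigma>)"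
    by (auto intro: inj_onI)
  ultimately show ?thesis
    by (simp add: invol_def card_image)
qed

lemma finite_reversers: "finite (reversers n \<sigma>)"
  by (rule finite_subset[OF _ finite_permutations[of "{1..n}"]])
     (auto simp: reversers_def involutions_def)

text \<open>As \<open>\<tau>\<close> and \<open>\<sigma> \<circ> \<tau>\<close> are involutions,
  \<open>\<sigma> \<circ> \<tau> \<circ> \<sigma> = \<tau>\<close>: conjugation by
  \<open>\<tau>\<close> inverts \<open>\<sigma>\<close>. Iterating shows that one value of
  \<open>\<tau>\<close> on a cycle fixes all its values there.\<close>

lemma reverser_iterate:
  assumes "\<tau> \<in> reversers n \<sigma>"
  shows "(\<sigma> ^^ k) (\<tau> ((\<sigma> ^^ k) y)) = \<tau> y"
proof (induction k arbitrary: y)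
  case (Suc k)
  have step: "\<sigma> (\<tau> (\<sigma> z)) = \<tau> z" for z
  proof -
    have "(\<sigma> \<circ> \<tau> \<circ> (\<sigma> \<circ> \<tau>)) (\<tau> z) = \<tau> z"
      using assms by (simp add: reversers_def involutions_def)
    moreover have "\<tau> (\<tau> z) = z"
      using assms by (simp add: reversers_def involutions_def fun_eq_iff)
    ultimately show ?thesis by simp
  qed
  have "(\<sigma> ^^ Suc k) (\<tau> ((\<sigma> ^^ Suc k) y)) = \<sigma> ((\<sigma> ^^ k) (\<tau> ((\<sigma> ^^ k) (\<sigma> y))))"
    by (simp add: funpow_swap1)
  also have "\<dots> = \<tau> y" by (simp add: Suc step)
  finally show ?case .
qed simp

text \<open>A reverser maps the cycle of \<open>x\<close> injectively into the cycle of
  \<open>\<tau> x\<close>, so the length cannot decrease. The same inequality at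
  \<open>\<tau> x\<close> leads back to \<open>x\<close> and gives equality.\<close>

lemma card_orbit_reverser:
  assumes \<sigma>: "\<sigma> permutes {1..n}" and \<tau>: "\<tau> \<in> reversers n \<sigma>"
  shows "card (orbit \<sigma> (\<tau> x)) = card (orbit \<sigma> x)"
proof -
  have p: "permutation \<sigma>" using permutes_imp_permutation[OF \<sigma>] .
  have inv: "\<tau> (\<tau> z) = z" for z
    using \<tau> by (simp add: reversers_def involutions_def fun_eq_iff)
  have le: "card (orbit \<sigma> z) \<le> card (orbit \<sigma> (\<tau> z))" for z
  proof (rule card_inj_on_le)
    show "inj_on \<tau> (orbit \<sigma> z)" by (metis inv inj_onI)
    show "\<tau> ` orbit \<sigma> z \<subseteq> orbit \<sigma> (\<tau> z)"
    proof safe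
      fix y assume "y \<in> orbit \<sigma> z"
      then obtain k where k: "y = (\<sigma> ^^ k) z"
        by (auto simp: orbit_altdef)
      have "\<tau> z = (\<sigma> ^^ k) (\<tau> y)" using reverser_iterate[OF \<tau>] k by simp
      then have "\<tau> z \<in> orbit \<sigma> (\<tau> y)"
        by (auto simp: orbit_altdef_permutation[OF p])
      then show "\<tau> y \<in> orbit \<sigma> (\<tau> z)"
        using orbit_eq_of_mem[OF p] permutation_self_in_orbit[OF p] by metis
    qed
  qed (rule finite_orbit_permutation[OF p])
  show ?thesis using le[of x] le[of "\<tau> x"] by (simp add: inv)
qed

text \<open>A reverser is determined by its values on the minima, and a minimum can only go to a
  point of a cycle of equal length. The number of cycles of that length is bounded crudely by the
  number K of all cycles, which costs at most K ln K in the logarithm.\<close>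

lemma invol_le:
  assumes \<sigma>: "\<sigma> permutes {1..n}"
  shows "invol n \<sigma> \<le> (\<Prod>i\<in>cycle_mins n \<sigma>. card (cycle_mins n \<sigma>) * card (orbit \<sigma> i))"
proof -
  have p: "permutation \<sigma>" using permutes_imp_permutation[OF \<sigma>] .
  define M where "M = cycle_mins n \<sigma>"
  define T where "T i = {y \<in> {1..n}. card (orbit \<sigma> y) = card (orbit \<sigma> i)}" for i
  have "card (reversers n \<sigma>) \<le> card (PiE M T)"
  proof (rule card_inj_on_le)
    show "inj_on (\<lambda>\<tau>. restrict \<tau> M) (reversers n \<sigma>)"
    proof (rule inj_onI)
      fix \<tau> \<tau>' assume \<tau>: "\<tau> \<in> reversers n \<sigma>" and \<tau>': "\<tau>' \<in> reversers n \<sigma>"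
        and eq: "restrict \<tau> M = restrict \<tau>' M"
      show "\<tau> = \<tau>'"
      proof
        fix x show "\<tau> x = \<tau>' x"
        proof (cases "x \<in> {1..n}")
          case False
          have "\<tau> permutes {1..n}" "\<tau>' permutes {1..n}"
            using \<tau> \<tau>' by (simp_all add: reversers_def involutions_def)
          then show ?thesis using permutes_not_in[OF _ False] by metis
        next
          case True
          then obtain i where i: "i \<in> M" "x \<in> orbit \<sigma> i"
            using cycle_mins_cover[OF \<sigma> True] unfolding M_def by blast
          then obtain k where k: "x = (\<sigma> ^^ k) i" by (auto simp: orbit_altdef)
          \<comment> \<open>Both sides are the common value of the two reversers at the minimum
            \<open>i\<close>, from which \<open>x\<close> is \<open>k\<close> steps away.\<close>
          have "(\<sigma> ^^ k) (\<tau> x) = (\<sigma> ^^ k) (\<tau>' x)"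
            using reverser_iterate[OF \<tau>] reverser_iterate[OF \<tau>'] fun_cong[OF eq, of i] i(1) k
            by simp
          moreover have "inj (\<sigma> ^^ k)"
            using permutes_inj[OF permutes_funpow[OF \<sigma>]] .
          ultimately show ?thesis by (simp add: inj_eq)
        qed
      qed
    qed
    show "(\<lambda>\<tau>. restrict \<tau> M) ` reversers n \<sigma> \<subseteq> PiE M T"
    proof (intro image_subsetI PiE_I)
      fix \<tau> i assume \<tau>: "\<tau> \<in> reversers n \<sigma>" and i: "i \<in> M"
      have "\<tau> permutes {1..n}" using \<tau> by (simp add: reversers_def involutions_def)
      then have "\<tau> i \<in> {1..n}" using i permutes_in_image[of \<tau> "{1..n}"]
        by (auto simp: M_def cycle_mins_def)
      then show "restrict \<tau> M i \<in> T i"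
        using i card_orbit_reverser[OF \<sigma> \<tau>] by (simp add: T_def)
    qed simp
    show "finite (PiE M T)" by (intro finite_PiE) (auto simp: M_def T_def)
  qed
  also have "card (PiE M T) = (\<Prod>i\<in>M. card (T i))"
    by (rule card_PiE) (simp add: M_def)
  also have "\<dots> \<le> (\<Prod>i\<in>M. card M * card (orbit \<sigma> i))"
  proof (rule prod_mono, safe)
    fix i assume "i \<in> M"
    have "T i \<subseteq> (\<Union>j\<in>{j\<in>M. card (orbit \<sigma> j) = card (orbit \<sigma> i)}. orbit \<sigma> j)"
    proof
      fix y assume "y \<in> T i"
      then have y: "y \<in> {1..n}" "card (orbit \<sigma> y) = card (orbit \<sigma> i)" by (auto simp: T_def)
      obtain j where "j \<in> M" "y \<in> orbit \<sigma> j" "orbit \<sigma> j = orbit \<sigma> y"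
        using cycle_mins_cover[OF \<sigma> y(1)] unfolding M_def by blast
      with y(2) show "y \<in> (\<Union>j\<in>{j\<in>M. card (orbit \<sigma> j) = card (orbit \<sigma> i)}. orbit \<sigma> j)"
        by (intro UN_I[of j]) simp_all
    qed
    then have "card (T i) \<le> card (\<Union>j\<in>{j\<in>M. card (orbit \<sigma> j) = card (orbit \<sigma> i)}. orbit \<sigma> j)"
      by (intro card_mono) (auto simp: M_def finite_orbit_permutation[OF p])
    also have "\<dots> \<le> (\<Sum>j\<in>{j\<in>M. card (orbit \<sigma> j) = card (orbit \<sigma> i)}. card (orbit \<sigma> j))"
      by (rule card_UN_le) (auto simp: M_def)
    also have "\<dots> = card {j\<in>M. card (orbit \<sigma> j) = card (orbit \<sigma> i)} * card (orbit \<sigma> i)"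
      by simp
    also have "\<dots> \<le> card M * card (orbit \<sigma> i)"
      by (intro mult_right_mono card_mono) (auto simp: M_def)
    finally show "card (T i) \<le> card M * card (orbit \<sigma> i)" .
  qed
  finally show ?thesis by (simp add: invol_eq_card_reversers M_def)
qed

text \<open>The reverser reflects each cycle: the point \<open>k\<close> steps after a minimum
  \<open>r\<close> goes to the point \<open>k\<close> steps before \<open>f r\<close>. Every cycle
  is mapped to itself, so the choices on different cycles do not interact.\<close>

lemma reverser_exists:
  assumes \<sigma>: "\<sigma> permutes {1..n}"
    and f: "\<And>i. i \<in> cycle_mins n \<sigma> \<Longrightarrow> f i \<in> orbit \<sigma> i"
  shows "\<exists>\<tau>\<in>reversers n \<sigma>. \<forall>i\<in>cycle_mins n \<sigma>. \<tau> i = f i"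
proof -
  have p: "permutation \<sigma>" using permutes_imp_permutation[OF \<sigma>] .
  have inj: "inj (\<sigma> ^^ k)" for k
    using permutes_inj[OF permutes_funpow[OF \<sigma>]] .
  have comm: "(\<sigma> ^^ k) ((\<sigma> ^^ l) z) = (\<sigma> ^^ l) ((\<sigma> ^^ k) z)" for k l z
    by (metis add.commute comp_apply funpow_add)
  have ex: "\<exists>r k. r \<in> cycle_mins n \<sigma> \<and> x = (\<sigma> ^^ k) r" if xn: "x \<in> {1..n}" for x
  proof -
    obtain r where r: "r \<in> cycle_mins n \<sigma>" "x \<in> orbit \<sigma> r"
      using cycle_mins_cover[OF \<sigma> xn] by blast
    from r(2) obtain k where "x = (\<sigma> ^^ k) r" by (auto simp: orbit_altdef)
    with r(1) show ?thesis by blast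
  qed
  then have "\<forall>x\<in>{1..n}. \<exists>r k. r \<in> cycle_mins n \<sigma> \<and> x = (\<sigma> ^^ k) r" by blast
  then obtain rep dist where "\<forall>x\<in>{1..n}. rep x \<in> cycle_mins n \<sigma> \<and> x = (\<sigma> ^^ dist x) (rep x)"
    unfolding bchoice_iff by blast
  then have rd: "rep x \<in> cycle_mins n \<sigma>" "x = (\<sigma> ^^ dist x) (rep x)" if "x \<in> {1..n}" for x
    using that by blast+
  \<comment> \<open>\<open>dist x\<close> is an arbitrary number of steps leading from the minimum
    \<open>rep x\<close> to \<open>x\<close>; it is unique only modulo the cycle length.\<close>
  define \<tau> where "\<tau> x = (if x \<in> {1..n} then inv (\<sigma> ^^ dist x) (f (rep x)) else x)" for x
  \<comment> \<open>The reflection formula holds for every number of steps \<open>k\<close>, not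
    only for the chosen one. The point \<open>\<tau> x\<close> is itself an iterate of
    \<open>\<sigma>\<close> at \<open>r\<close>, and iterates commute, so two powers of
    \<open>\<sigma>\<close> that agree at \<open>r\<close> also agree at
    \<open>\<tau> x\<close>.\<close>
  have key: "(\<sigma> ^^ k) (\<tau> ((\<sigma> ^^ k) r)) = f r \<and> \<tau> ((\<sigma> ^^ k) r) \<in> orbit \<sigma> r"
    if r: "r \<in> cycle_mins n \<sigma>" for k r
  proof -
    define x where "x = (\<sigma> ^^ k) r"
    have "r \<in> {1..n}" using r by (simp add: cycle_mins_def)
    then have x: "x \<in> {1..n}" unfolding x_def
      by (simp only: permutes_in_image[OF permutes_funpow[OF \<sigma>]])
    have "x \<in> orbit \<sigma> r" unfolding x_def orbit_altdef_permutation[OF p] by blast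
    moreover have "x \<in> orbit \<sigma> (rep x)"
      unfolding orbit_altdef_permutation[OF p] using rd(2)[OF x] by blast
    ultimately
    have [simp]: "rep x = r" using cycle_mins_unique[OF p rd(1)[OF x] r] by blast
    define l where "l = dist x"
    have l: "x = (\<sigma> ^^ l) r" using rd(2)[OF x] by (simp add: l_def)
    have "surj (\<sigma> ^^ l)" using permutes_surj[OF permutes_funpow[OF \<sigma>]] .
    then have 1: "(\<sigma> ^^ l) (\<tau> x) = f r" using x by (simp add: \<tau>_def l_def surj_f_inv_f)
    then have "f r \<in> orbit \<sigma> (\<tau> x)"
      unfolding orbit_altdef_permutation[OF p] mem_Collect_eq by (intro exI[of _ l]) simp
    then have 2: "\<tau> x \<in> orbit \<sigma> r"
      using f[OF r] orbit_eq_of_mem[OF p] permutation_self_in_orbit[OF p] by metis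
    then obtain j where j: "\<tau> x = (\<sigma> ^^ j) r" by (auto simp: orbit_altdef)
    have "(\<sigma> ^^ k) (\<tau> x) = (\<sigma> ^^ j) ((\<sigma> ^^ k) r)"
      unfolding j by (rule comm)
    also have "\<dots> = (\<sigma> ^^ j) ((\<sigma> ^^ l) r)" using l x_def by simp
    also have "\<dots> = (\<sigma> ^^ l) (\<tau> x)" unfolding j by (rule comm)
    finally have "(\<sigma> ^^ k) (\<tau> x) = f r" using 1 by simp
    with 2 show ?thesis by (simp add: x_def)
  qed
  have in_set: "\<tau> x \<in> {1..n} \<and> \<tau> (\<tau> x) = x \<and> \<sigma> (\<tau> (\<sigma> x)) = \<tau> x" if x: "x \<in> {1..n}" for x
  proof -
    obtain r k where r: "r \<in> cycle_mins n \<sigma>" and k: "x = (\<sigma> ^^ k) r"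
      using ex[OF x] by blast
    have rn: "r \<in> {1..n}" using r by (simp add: cycle_mins_def)
    have 1: "(\<sigma> ^^ k) (\<tau> x) = f r" "\<tau> x \<in> orbit \<sigma> r" using key[OF r] k by auto
    then obtain j where j: "\<tau> x = (\<sigma> ^^ j) r" by (auto simp: orbit_altdef)
    \<comment> \<open>With \<open>x\<close> at \<open>k\<close> steps and \<open>\<tau> x\<close> at
      \<open>j\<close> steps from \<open>r\<close>, the relation between them is symmetric in
      \<open>j\<close> and \<open>k\<close>: both say that \<open>j + k\<close> steps lead from
      \<open>r\<close> to \<open>f r\<close>. Hence \<open>\<tau>\<close> is an involution.\<close>
    have "(\<sigma> ^^ j) (\<tau> (\<tau> x)) = f r" using key[OF r, of j] j by simp
    also have "\<dots> = (\<sigma> ^^ k) ((\<sigma> ^^ j) r)" using 1 j by simp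
    also have "\<dots> = (\<sigma> ^^ j) x" unfolding k by (rule comm)
    finally have "(\<sigma> ^^ j) (\<tau> (\<tau> x)) = (\<sigma> ^^ j) x" .
    then have "\<tau> (\<tau> x) = x" using inj by (simp add: inj_eq)
    moreover have "(\<sigma> ^^ k) (\<sigma> (\<tau> (\<sigma> x))) = (\<sigma> ^^ k) (\<tau> x)"
      using key[OF r, of "Suc k"] 1 k by (simp add: funpow_swap1)
    then have "\<sigma> (\<tau> (\<sigma> x)) = \<tau> x" using inj by (simp add: inj_eq)
    ultimately show ?thesis using 1(2) permutes_orbit_subset[OF \<sigma> rn] by auto
  qed
  have out: "\<tau> x = x" "\<sigma> x = x" if "x \<notin> {1..n}" for x
    using that \<sigma> by (auto simp: \<tau>_def permutes_def)
  have inv: "\<tau> (\<tau> x) = x" for x using in_set out by metis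
  have "\<sigma> (\<tau> (\<sigma> x)) = \<tau> x" for x using in_set out by metis
  then have srev: "(\<sigma> \<circ> \<tau>) \<circ> (\<sigma> \<circ> \<tau>) = id" using inv by (auto simp: fun_eq_iff)
  have \<tau>: "\<tau> permutes {1..n}"
    by (rule bij_imp_permutes[OF bij_betw_byWitness[where f'=\<tau>]])
       (use in_set inv out in auto)
  have "\<tau> \<in> reversers n \<sigma>"
    using \<tau> inv srev permutes_compose[OF \<tau> \<sigma>]
    by (auto simp: reversers_def involutions_def fun_eq_iff)
  moreover have "\<tau> i = f i" if "i \<in> cycle_mins n \<sigma>" for i
    using key[OF that, of 0] by simp
  ultimately show ?thesis by blast
qed

text \<open>Only reversers that send each minimum into its own cycle are counted here. Every choice
  of such images extends to a reverser, and different choices give different ones.\<close>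

lemma invol_ge:
  assumes \<sigma>: "\<sigma> permutes {1..n}"
  shows "(\<Prod>i\<in>cycle_mins n \<sigma>. card (orbit \<sigma> i)) \<le> invol n \<sigma>"
proof -
  define M where "M = cycle_mins n \<sigma>"
  have "PiE M (orbit \<sigma>) \<subseteq> (\<lambda>\<tau>. restrict \<tau> M) ` reversers n \<sigma>"
  proof
    fix f assume f: "f \<in> PiE M (orbit \<sigma>)"
    then have "f i \<in> orbit \<sigma> i" if "i \<in> cycle_mins n \<sigma>" for i
      using that by (auto simp: M_def)
    from reverser_exists[OF \<sigma> this] obtain \<tau> where \<tau>: "\<tau> \<in> reversers n \<sigma>" "\<forall>i\<in>M. \<tau> i = f i"
      unfolding M_def by blast
    have "f = restrict \<tau> M"
    proof
      fix i show "f i = restrict \<tau> M i"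
        using PiE_arb[OF f] \<tau>(2) by (cases "i \<in> M") simp_all
    qed
    then show "f \<in> (\<lambda>\<tau>. restrict \<tau> M) ` reversers n \<sigma>" using \<tau>(1) by blast
  qed
  then have "card (PiE M (orbit \<sigma>)) \<le> card (reversers n \<sigma>)"
    using surj_card_le[OF finite_reversers] by blast
  then show ?thesis
    by (simp add: card_PiE M_def invol_eq_card_reversers)
qed

lemma ln_invol_bounds:
  assumes \<sigma>: "\<sigma> permutes {1..n}"
  defines "M \<equiv> cycle_mins n \<sigma>"
  shows "(\<Sum>i\<in>M. ln (real (card (orbit \<sigma> i)))) \<le> ln (real (invol n \<sigma>))"
    and "ln (real (invol n \<sigma>)) \<le> (\<Sum>i\<in>M. ln (real (card (orbit \<sigma> i)))) + real (card M) * ln (real (card M))"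
proof -
  have pos: "0 < card (orbit \<sigma> i)" for i
    by (rule card_orbit_pos[OF permutes_imp_permutation[OF \<sigma>]])
  have ge: "(\<Prod>i\<in>M. real (card (orbit \<sigma> i))) \<le> real (invol n \<sigma>)"
    using of_nat_mono[OF invol_ge[OF \<sigma>], where 'a=real] by (simp add: M_def)
  moreover have ppos: "0 < (\<Prod>i\<in>M. real (card (orbit \<sigma> i)))"
    by (rule prod_pos) (simp add: pos)
  ultimately have "ln (\<Prod>i\<in>M. real (card (orbit \<sigma> i))) \<le> ln (real (invol n \<sigma>))"
    by (rule ln_mono)
  moreover have "ln (\<Prod>i\<in>M. real (card (orbit \<sigma> i))) = (\<Sum>i\<in>M. ln (real (card (orbit \<sigma> i))))"
    using pos by (intro ln_prod) (simp_all add: M_def)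
  ultimately show "(\<Sum>i\<in>M. ln (real (card (orbit \<sigma> i)))) \<le> ln (real (invol n \<sigma>))" by simp
  have "real (invol n \<sigma>) \<le> real (\<Prod>i\<in>M. card M * card (orbit \<sigma> i))"
    unfolding M_def by (rule of_nat_mono[OF invol_le[OF \<sigma>]])
  also have "\<dots> = (\<Prod>i\<in>M. real (card M) * real (card (orbit \<sigma> i)))" by simp
  finally have "ln (real (invol n \<sigma>)) \<le> ln (\<Prod>i\<in>M. real (card M) * real (card (orbit \<sigma> i)))"
    by (rule ln_mono[OF _ less_le_trans[OF ppos ge]])
  also have "\<dots> = (\<Sum>i\<in>M. ln (real (card M) * real (card (orbit \<sigma> i))))"
  \<comment> \<open>Without minima, that is for \<open>n = 0\<close>, the product is empty and both
    sides vanish; otherwise \<open>card M\<close> is positive and all factors are positive.\<close>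
  proof (cases "M = {}")
    case False
    then have "0 < card M" by (simp add: M_def card_gt_0_iff)
    then show ?thesis using pos by (intro ln_prod) (auto simp: M_def card_gt_0_iff)
  qed simp
  also have "\<dots> = (\<Sum>i\<in>M. ln (real (card M)) + ln (real (card (orbit \<sigma> i))))"
  proof (rule sum.cong)
    fix i assume "i \<in> M"
    then have "0 < card M" by (auto simp: M_def card_gt_0_iff)
    then show "ln (real (card M) * real (card (orbit \<sigma> i))) =
        ln (real (card M)) + ln (real (card (orbit \<sigma> i)))"
      using pos[of i] by (intro ln_mult_pos) simp_all
  qed simp
  also have "\<dots> = (\<Sum>i\<in>M. ln (real (card (orbit \<sigma> i)))) + real (card M) * ln (real (card M))"
    by (simp add: sum.distrib)
  finally show "ln (real (invol n \<sigma>)) \<le> (\<Sum>i\<in>M. ln (real (card (orbit \<sigma> i)))) + real (card M) * ln (real (card M))" .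
qed

section \<open>The Chinese restaurant process\<close>

text \<open>Composing on the left with the transposition of \<open>Suc n\<close> and
  \<open>b\<close> inserts \<open>Suc n\<close> into the cycle of \<open>b\<close>, immediately
  before \<open>b\<close>. These three equations describe the new successor of \<open>Suc n\<close>,
  the unchanged successors, and the redirected predecessor of \<open>b\<close>.\<close>

lemma transpose_comp_apply:
  assumes "\<sigma> permutes {1..n}" "b \<in> {1..n}"
  shows "(Transposition.transpose (Suc n) b \<circ> \<sigma>) (Suc n) = b"
    and "x \<in> {1..n} \<Longrightarrow> \<sigma> x \<noteq> b \<Longrightarrow> (Transposition.transpose (Suc n) b \<circ> \<sigma>) x = \<sigma> x"
    and "\<sigma> x = b \<Longrightarrow> (Transposition.transpose (Suc n) b \<circ> \<sigma>) x = Suc n"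
proof -
  have "\<sigma> (Suc n) = Suc n" using assms(1) by (simp add: permutes_not_in)
  then show "(Transposition.transpose (Suc n) b \<circ> \<sigma>) (Suc n) = b" by simp
  show "(Transposition.transpose (Suc n) b \<circ> \<sigma>) x = \<sigma> x" if "x \<in> {1..n}" "\<sigma> x \<noteq> b"
  proof -
    have "\<sigma> x \<in> {1..n}" using that(1) permutes_in_image[OF assms(1)] by simp
    then have "\<sigma> x \<noteq> Suc n" by auto
    then show ?thesis using that by (simp add: transpose_apply_other)
  qed
  show "(Transposition.transpose (Suc n) b \<circ> \<sigma>) x = Suc n" if "\<sigma> x = b"
    using that by simp
qed

lemma orbit_transpose_comp_disjoint:
  assumes \<sigma>: "\<sigma> permutes {1..n}" and b: "b \<in> {1..n}" and x: "x \<in> {1..n}"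
    and nb: "b \<notin> orbit \<sigma> x"
  shows "orbit (Transposition.transpose (Suc n) b \<circ> \<sigma>) x = orbit \<sigma> x"
proof (rule orbit_cong)
  show "x \<in> orbit \<sigma> x" using permutation_self_in_orbit[OF permutes_imp_permutation[OF \<sigma>]] .
  fix s assume s: "s \<in> orbit \<sigma> x"
  have "s \<in> {1..n}" using permutes_orbit_subset[OF \<sigma> x] s by blast
  moreover have "\<sigma> s \<noteq> b" using orbit.step[OF s] nb by metis
  ultimately show "(Transposition.transpose (Suc n) b \<circ> \<sigma>) s = \<sigma> s"
    by (rule transpose_comp_apply(2)[OF \<sigma> b])
qed

lemma permutes_transpose_comp:
  assumes "\<sigma> permutes {1..n}" "b \<in> {1..Suc n}"
  shows "(Transposition.transpose (Suc n) b \<circ> \<sigma>) permutes {1..Suc n}"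
proof (rule permutes_compose)
  show "\<sigma> permutes {1..Suc n}" by (rule permutes_subset[OF assms(1)]) auto
  show "Transposition.transpose (Suc n) b permutes {1..Suc n}"
    using assms(2) by (intro permutes_swap_id) auto
qed

lemma orbit_transpose_comp_new:
  assumes \<sigma>: "\<sigma> permutes {1..n}" and b: "b \<in> {1..n}"
  shows "orbit (Transposition.transpose (Suc n) b \<circ> \<sigma>) (Suc n) = insert (Suc n) (orbit \<sigma> b)"
proof -
  define \<tau> where "\<tau> = Transposition.transpose (Suc n) b \<circ> \<sigma>"
  have p: "permutation \<sigma>" using permutes_imp_permutation[OF \<sigma>] .
  note \<tau> = transpose_comp_apply[OF \<sigma> b, folded \<tau>_def]
  have b_in: "b \<in> orbit \<tau> (Suc n)" using orbit.base[of \<tau> "Suc n"] \<tau>(1) by simp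
  have fwd: "y \<in> insert (Suc n) (orbit \<sigma> b)" if "y \<in> orbit \<tau> (Suc n)" for y
    using that
  proof induction
    case base
    then show ?case using \<tau>(1) permutation_self_in_orbit[OF p] by simp
  next
    case (step y)
    show ?case
    proof (cases "y = Suc n")
      case True
      then show ?thesis using \<tau>(1) permutation_self_in_orbit[OF p] by simp
    next
      case False
      then have y: "y \<in> orbit \<sigma> b" using step by simp
      then have "y \<in> {1..n}" using permutes_orbit_subset[OF \<sigma> b] by blast
      then show ?thesis using \<tau>(2,3) orbit.step[OF y] by (cases "\<sigma> y = b") auto
    qed
  qed
  \<comment> \<open>The new permutation follows \<open>\<sigma>\<close> except at the predecessor of
    \<open>b\<close>. There the next iterate of \<open>\<sigma>\<close> is \<open>b\<close>, which
    is already known to be in the orbit.\<close>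
  have bwd: "(\<sigma> ^^ k) b \<in> orbit \<tau> (Suc n)" for k
  proof (induction k)
    case 0
    then show ?case using b_in by simp
  next
    case (Suc k)
    have "(\<sigma> ^^ k) b \<in> {1..n}"
      using permutes_in_image[OF permutes_funpow[OF \<sigma>]] b by blast
    then show ?case using \<tau>(2)[of "(\<sigma> ^^ k) b"] orbit.step[OF Suc] b_in
      by (cases "\<sigma> ((\<sigma> ^^ k) b) = b") auto
  qed
  have "\<tau> permutes {1..Suc n}"
    using permutes_transpose_comp[OF \<sigma>, of b] b by (simp add: \<tau>_def)
  then have "Suc n \<in> orbit \<tau> (Suc n)"
    by (intro permutation_self_in_orbit permutes_imp_permutation)
  moreover have "orbit \<sigma> b \<subseteq> orbit \<tau> (Suc n)"
    unfolding orbit_altdef_permutation[OF p] using bwd by blast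
  ultimately show ?thesis using fwd unfolding \<tau>_def by blast
qed

lemma orbit_transpose_comp_same:
  assumes \<sigma>: "\<sigma> permutes {1..n}" and b: "b \<in> {1..n}" and bx: "b \<in> orbit \<sigma> x"
  shows "orbit (Transposition.transpose (Suc n) b \<circ> \<sigma>) x = insert (Suc n) (orbit \<sigma> x)"
proof -
  have p: "permutation \<sigma>" using permutes_imp_permutation[OF \<sigma>] .
  have eq: "orbit \<sigma> b = orbit \<sigma> x" using orbit_eq_of_mem[OF p bx] .
  have new: "orbit (Transposition.transpose (Suc n) b \<circ> \<sigma>) (Suc n) = insert (Suc n) (orbit \<sigma> x)"
    using orbit_transpose_comp_new[OF \<sigma> b] eq by simp
  have "permutation (Transposition.transpose (Suc n) b \<circ> \<sigma>)"
    using permutes_imp_permutation[OF permutes_transpose_comp[OF \<sigma>, of b]] b by simp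
  moreover have "x \<in> orbit (Transposition.transpose (Suc n) b \<circ> \<sigma>) (Suc n)"
    using permutation_self_in_orbit[OF p] by (simp add: new)
  ultimately show ?thesis using orbit_eq_of_mem new by metis
qed

lemma card_orbit_transpose_comp:
  assumes \<sigma>: "\<sigma> permutes {1..n}" and b: "b \<in> {1..n}" and x: "x \<in> {1..n}"
  shows "card (orbit (Transposition.transpose (Suc n) b \<circ> \<sigma>) x) =
    (if b \<in> orbit \<sigma> x then Suc (card (orbit \<sigma> x)) else card (orbit \<sigma> x))"
proof -
  have "Suc n \<notin> orbit \<sigma> x" using permutes_orbit_subset[OF \<sigma> x] by auto
  moreover have "finite (orbit \<sigma> x)"
    by (rule finite_orbit_permutation[OF permutes_imp_permutation[OF \<sigma>]])
  ultimately show ?thesis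
    using orbit_transpose_comp_same[OF \<sigma> b] orbit_transpose_comp_disjoint[OF \<sigma> b x] by simp
qed

text \<open>The inserted element is larger than all others and joins an existing cycle, so it
  neither becomes a minimum nor displaces one.\<close>

lemma cycle_mins_transpose_comp:
  assumes \<sigma>: "\<sigma> permutes {1..n}" and b: "b \<in> {1..n}"
  shows "cycle_mins (Suc n) (Transposition.transpose (Suc n) b \<circ> \<sigma>) = cycle_mins n \<sigma>"
proof -
  define \<tau> where "\<tau> = Transposition.transpose (Suc n) b \<circ> \<sigma>"
  have new: "b \<in> orbit \<tau> (Suc n)"
    using orbit_transpose_comp_new[OF \<sigma> b]
      permutation_self_in_orbit[OF permutes_imp_permutation[OF \<sigma>]] by (simp add: \<tau>_def)
  have old: "(\<forall>j\<in>orbit \<tau> i. i \<le> j) \<longleftrightarrow> (\<forall>j\<in>orbit \<sigma> i. i \<le> j)" if i: "i \<in> {1..n}" for i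
    using orbit_transpose_comp_same[OF \<sigma> b, of i] orbit_transpose_comp_disjoint[OF \<sigma> b i] i
    by (cases "b \<in> orbit \<sigma> i") (auto simp: \<tau>_def)
  have "i \<in> cycle_mins (Suc n) \<tau> \<longleftrightarrow> i \<in> cycle_mins n \<sigma>" for i
  proof (cases "i = Suc n")
    case True
    then have "\<not> (\<forall>j\<in>orbit \<tau> i. i \<le> j)" using new b by fastforce
    then show ?thesis using True by (simp add: cycle_mins_def)
  next
    case False
    then have "i \<in> {1..Suc n} \<longleftrightarrow> i \<in> {1..n}" by auto
    then show ?thesis using old unfolding cycle_mins_def by blast
  qed
  then show ?thesis by (auto simp: \<tau>_def)
qed

lemma cycle_mins_fixed:
  assumes \<sigma>: "\<sigma> permutes {1..n}"
  shows "cycle_mins (Suc n) \<sigma> = insert (Suc n) (cycle_mins n \<sigma>)"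
proof -
  have "\<sigma> (Suc n) = Suc n" using \<sigma> by (simp add: permutes_not_in)
  then have "orbit \<sigma> (Suc n) = {Suc n}" by (simp add: orbit_eq_singleton_iff)
  then have new: "\<forall>j\<in>orbit \<sigma> (Suc n). Suc n \<le> j" by simp
  have "i \<in> cycle_mins (Suc n) \<sigma> \<longleftrightarrow> i \<in> insert (Suc n) (cycle_mins n \<sigma>)" for i
  proof (cases "i = Suc n")
    case True
    then show ?thesis using new by (simp add: cycle_mins_def)
  next
    case False
    then have "i \<in> {1..Suc n} \<longleftrightarrow> i \<in> {1..n}" by auto
    then show ?thesis using False unfolding cycle_mins_def by blast
  qed
  then show ?thesis by blast
qed

lemma Suc_notin_cycle_mins [simp]: "Suc n \<notin> cycle_mins n \<sigma>"
  by (simp add: cycle_mins_def)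

text \<open>Every permutation of {1..Suc n} arises exactly once by composing a permutation of {1..n}
  with the transposition of \<open>Suc n\<close> and some \<open>b\<close> in {1..Suc n}. The case
  \<open>b = Suc n\<close> is the separate summand \<open>F \<sigma>\<close>, where the new element
  is a fixed point.\<close>

lemma sum_permutations_Suc:
  "(\<Sum>\<sigma> | \<sigma> permutes {1..Suc n}. F \<sigma>) =
   (\<Sum>\<sigma> | \<sigma> permutes {1..n}. F \<sigma> + (\<Sum>b=1..n. F (Transposition.transpose (Suc n) b \<circ> \<sigma>)))"
proof -
  have "{1..Suc n} = insert (Suc n) {1..n}" by auto
  then have "(\<Sum>\<sigma> | \<sigma> permutes {1..Suc n}. F \<sigma>) =
      (\<Sum>b\<in>insert (Suc n) {1..n}. \<Sum>\<sigma> | \<sigma> permutes {1..n}. F (Transposition.transpose (Suc n) b \<circ> \<sigma>))"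
    by (simp only:) (rule sum_over_permutations_insert; simp)
  also have "\<dots> = (\<Sum>\<sigma> | \<sigma> permutes {1..n}. \<Sum>b\<in>insert (Suc n) {1..n}. F (Transposition.transpose (Suc n) b \<circ> \<sigma>))"
    by (rule sum.swap)
  also have "\<dots> = (\<Sum>\<sigma> | \<sigma> permutes {1..n}. F \<sigma> + (\<Sum>b=1..n. F (Transposition.transpose (Suc n) b \<circ> \<sigma>)))"
    by (intro sum.cong) simp_all
  finally show ?thesis .
qed

text \<open>Inserting \<open>Suc n\<close> as a fixed point multiplies the product by
  \<open>w (Suc n)\<close>, and each of the \<open>n\<close> other positions multiplies it by 1. The
  total factor does not depend on \<open>\<sigma>\<close>, which is the source of independence. The
  general ring covers both real and complex weights.\<close>

lemma sum_prod_cycle_mins: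
  fixes w :: "nat \<Rightarrow> 'a :: comm_ring_1"
  shows "(\<Sum>\<sigma> | \<sigma> permutes {1..n}. \<Prod>i\<in>cycle_mins n \<sigma>. w i) = (\<Prod>i=1..n. w i + of_nat (i - 1))"
proof (induction n)
  case 0
  have "{\<sigma>. \<sigma> permutes {1..0::nat}} = {id}" by auto
  then show ?case by (simp add: cycle_mins_def)
next
  case (Suc n)
  have "(\<Sum>\<sigma> | \<sigma> permutes {1..Suc n}. \<Prod>i\<in>cycle_mins (Suc n) \<sigma>. w i) =
     (\<Sum>\<sigma> | \<sigma> permutes {1..n}. (\<Prod>i\<in>cycle_mins (Suc n) \<sigma>. w i) +
       (\<Sum>b=1..n. \<Prod>i\<in>cycle_mins (Suc n) (Transposition.transpose (Suc n) b \<circ> \<sigma>). w i))"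
    by (rule sum_permutations_Suc)
  also have "\<dots> = (\<Sum>\<sigma> | \<sigma> permutes {1..n}. (\<Prod>i\<in>cycle_mins n \<sigma>. w i) * (w (Suc n) + of_nat n))"
  proof (intro sum.cong refl)
    fix \<sigma> assume "\<sigma> \<in> {\<sigma>. \<sigma> permutes {1..n}}"
    then have \<sigma>: "\<sigma> permutes {1..n}" by simp
    have "(\<Sum>b=1..n. \<Prod>i\<in>cycle_mins (Suc n) (Transposition.transpose (Suc n) b \<circ> \<sigma>). w i) =
        (\<Sum>b=1..n. \<Prod>i\<in>cycle_mins n \<sigma>. w i)"
      by (intro sum.cong refl) (simp only: cycle_mins_transpose_comp[OF \<sigma>])
    then show "(\<Prod>i\<in>cycle_mins (Suc n) \<sigma>. w i) +
       (\<Sum>b=1..n. \<Prod>i\<in>cycle_mins (Suc n) (Transposition.transpose (Suc n) b \<circ> \<sigma>). w i) =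
       (\<Prod>i\<in>cycle_mins n \<sigma>. w i) * (w (Suc n) + of_nat n)"
      by (simp add: cycle_mins_fixed[OF \<sigma>] algebra_simps)
  qed
  also have "\<dots> = (\<Prod>i=1..Suc n. w i + of_nat (i - 1))"
    by (simp add: sum_distrib_right[symmetric] Suc[unfolded One_nat_def])
  finally show ?case .
qed

section \<open>Ewens expectations and the joint law of the cycle minima\<close>

definition ewens_weight :: "real \<Rightarrow> nat \<Rightarrow> (nat \<Rightarrow> nat) \<Rightarrow> real" where
  "ewens_weight \<theta> n \<sigma> = \<theta> ^ num_cycles n \<sigma> / pochhammer \<theta> n"

text \<open>Expectations stay finite sums throughout the estimates; a measure enters only for the
  continuity theorem at the end.\<close>

definition ewens_exp :: "real \<Rightarrow> nat \<Rightarrow> ((nat \<Rightarrow> nat) \<Rightarrow> real) \<Rightarrow> real" where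
  "ewens_exp \<theta> n F = (\<Sum>\<sigma> | \<sigma> permutes {1..n}. ewens_weight \<theta> n \<sigma> * F \<sigma>)"

text \<open>This is the probability that \<open>i\<close> opens a new cycle when it is inserted. The
  sums and products over \<open>i\<close> start at 1, where the truncated difference
  \<open>i - 1\<close> is exact.\<close>

definition ewens_p :: "real \<Rightarrow> nat \<Rightarrow> real" where
  "ewens_p \<theta> i = \<theta> / (\<theta> + real (i - 1))"

lemma ewens_p_pos: "\<theta> > 0 \<Longrightarrow> ewens_p \<theta> i > 0"
  by (simp add: ewens_p_def add_pos_nonneg)

lemma ewens_p_le_1: "\<theta> > 0 \<Longrightarrow> ewens_p \<theta> i \<le> 1"
  by (simp add: ewens_p_def)

lemma ewens_weight_nonneg: "\<theta> > 0 \<Longrightarrow> 0 \<le> ewens_weight \<theta> n \<sigma>"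
  by (simp add: ewens_weight_def pochhammer_nonneg)

lemma finite_permutes_interval [simp]: "finite {\<sigma>. \<sigma> permutes {m..n::nat}}"
  by (rule finite_permutations) simp

text \<open>The factors are the generating functions of independent Bernoulli variables with
  parameters \<open>ewens_p \<theta> i\<close>. With \<open>z\<close> constantly 1 this gives total
  mass 1, with a constant \<open>exp (1 / m)\<close> an exponential moment of the number of cycles,
  and with points of the complex unit circle a characteristic function.\<close>

lemma ewens_generating_function:
  fixes z :: "nat \<Rightarrow> 'a :: real_normed_field"
  assumes \<theta>: "\<theta> > 0"
  shows "(\<Sum>\<sigma> | \<sigma> permutes {1..n}. of_real (ewens_weight \<theta> n \<sigma>) * (\<Prod>i\<in>cycle_mins n \<sigma>. z i)) =
    (\<Prod>i=1..n. 1 + of_real (ewens_p \<theta> i) * (z i - 1))"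
proof -
  have poch: "pochhammer \<theta> n = (\<Prod>i=1..n. \<theta> + real (i - 1))"
    by (induction n) (simp_all add: pochhammer_Suc)
  have "(\<Sum>\<sigma> | \<sigma> permutes {1..n}. of_real (ewens_weight \<theta> n \<sigma>) * (\<Prod>i\<in>cycle_mins n \<sigma>. z i)) =
      (\<Sum>\<sigma> | \<sigma> permutes {1..n}. \<Prod>i\<in>cycle_mins n \<sigma>. of_real \<theta> * z i) / of_real (pochhammer \<theta> n)"
    unfolding sum_divide_distrib
  proof (intro sum.cong refl)
    fix \<sigma> assume "\<sigma> \<in> {\<sigma>. \<sigma> permutes {1..n}}"
    then show "of_real (ewens_weight \<theta> n \<sigma>) * (\<Prod>i\<in>cycle_mins n \<sigma>. z i) =
        (\<Prod>i\<in>cycle_mins n \<sigma>. of_real \<theta> * z i) / of_real (pochhammer \<theta> n)"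
      by (simp add: ewens_weight_def num_cycles_eq prod.distrib)
  qed
  also have "\<dots> = (\<Prod>i=1..n. (of_real \<theta> * z i + of_nat (i - 1)) / of_real (\<theta> + real (i - 1)))"
    by (simp only: sum_prod_cycle_mins poch of_real_prod prod_dividef)
  also have "\<dots> = (\<Prod>i=1..n. 1 + of_real (ewens_p \<theta> i) * (z i - 1))"
  proof (intro prod.cong refl)
    fix i
    have "\<theta> + real (i - 1) \<noteq> 0" using \<theta> by (simp add: add_pos_nonneg less_imp_neq[symmetric])
    then have "(of_real (\<theta> + real (i - 1)) :: 'a) \<noteq> 0" by (simp only: of_real_eq_0_iff not_False_eq_True)
    then show "(of_real \<theta> * z i + of_nat (i - 1)) / of_real (\<theta> + real (i - 1)) =
        1 + of_real (ewens_p \<theta> i) * (z i - 1)"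
      by (simp add: ewens_p_def field_simps)
  qed
  finally show ?thesis .
qed

lemma sum_ewens_weight:
  assumes "\<theta> > 0"
  shows "(\<Sum>\<sigma> | \<sigma> permutes {1..n}. ewens_weight \<theta> n \<sigma>) = 1"
  using ewens_generating_function[OF assms, of n "\<lambda>_. 1 :: real"] by simp

lemma ewens_exp_mono:
  assumes "\<theta> > 0" "\<And>\<sigma>. \<sigma> permutes {1..n} \<Longrightarrow> F \<sigma> \<le> G \<sigma>"
  shows "ewens_exp \<theta> n F \<le> ewens_exp \<theta> n G"
  unfolding ewens_exp_def using assms by (intro sum_mono mult_left_mono ewens_weight_nonneg) auto

lemma ewens_exp_add: "ewens_exp \<theta> n (\<lambda>\<sigma>. F \<sigma> + G \<sigma>) = ewens_exp \<theta> n F + ewens_exp \<theta> n G"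
  by (simp add: ewens_exp_def algebra_simps sum.distrib)

lemma ewens_exp_cmult: "ewens_exp \<theta> n (\<lambda>\<sigma>. c * F \<sigma>) = c * ewens_exp \<theta> n F"
  by (simp add: ewens_exp_def sum_distrib_left mult_ac)

lemma ewens_exp_sum: "ewens_exp \<theta> n (\<lambda>\<sigma>. \<Sum>i\<in>I. F i \<sigma>) = (\<Sum>i\<in>I. ewens_exp \<theta> n (F i))"
  unfolding ewens_exp_def by (subst sum.swap) (simp add: sum_distrib_left)

section \<open>Growth of the cycle with a given minimum\<close>

definition ewens_cyc :: "real \<Rightarrow> nat \<Rightarrow> nat \<Rightarrow> (nat \<Rightarrow> real) \<Rightarrow> real" where
  "ewens_cyc \<theta> n i g = ewens_exp \<theta> n (\<lambda>\<sigma>. if i \<in> cycle_mins n \<sigma> then g (card (orbit \<sigma> i)) else 0)"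

text \<open>This is one step of the Chinese restaurant process: given \<open>\<sigma>\<close>, the
  new element is alone with probability \<open>\<theta> / (\<theta> + n)\<close> and sits before
  each \<open>b\<close> with probability \<open>1 / (\<theta> + n)\<close>.\<close>

lemma ewens_exp_Suc:
  assumes \<theta>: "\<theta> > 0"
  shows "ewens_exp \<theta> (Suc n) F = ewens_exp \<theta> n
    (\<lambda>\<sigma>. (\<theta> * F \<sigma> + (\<Sum>b=1..n. F (Transposition.transpose (Suc n) b \<circ> \<sigma>))) / (\<theta> + real n))"
  unfolding ewens_exp_def sum_permutations_Suc
proof (intro sum.cong refl)
  fix \<sigma> assume "\<sigma> \<in> {\<sigma>. \<sigma> permutes {1..n}}"
  then have \<sigma>: "\<sigma> permutes {1..n}" by simp
  then have \<sigma>': "\<sigma> permutes {1..Suc n}" by (rule permutes_subset) auto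
  have 1: "ewens_weight \<theta> (Suc n) \<sigma> = ewens_weight \<theta> n \<sigma> * (\<theta> / (\<theta> + real n))"
    by (simp add: ewens_weight_def num_cycles_eq[OF \<sigma>] num_cycles_eq[OF \<sigma>']
        cycle_mins_fixed[OF \<sigma>] pochhammer_Suc)
  have 2: "ewens_weight \<theta> (Suc n) (Transposition.transpose (Suc n) b \<circ> \<sigma>) = ewens_weight \<theta> n \<sigma> / (\<theta> + real n)"
    if "b \<in> {1..n}" for b
    using num_cycles_eq[OF permutes_transpose_comp[OF \<sigma>, of b]] that
    by (simp add: ewens_weight_def num_cycles_eq[OF \<sigma>] cycle_mins_transpose_comp[OF \<sigma> that] pochhammer_Suc)
  have "(\<Sum>b=1..n. ewens_weight \<theta> (Suc n) (Transposition.transpose (Suc n) b \<circ> \<sigma>) * F (Transposition.transpose (Suc n) b \<circ> \<sigma>)) =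
      ewens_weight \<theta> n \<sigma> * ((\<Sum>b=1..n. F (Transposition.transpose (Suc n) b \<circ> \<sigma>)) / (\<theta> + real n))"
    unfolding sum_divide_distrib sum_distrib_left by (intro sum.cong refl) (simp add: 2)
  then show "ewens_weight \<theta> (Suc n) \<sigma> * F \<sigma> +
      (\<Sum>b=1..n. ewens_weight \<theta> (Suc n) (Transposition.transpose (Suc n) b \<circ> \<sigma>) * F (Transposition.transpose (Suc n) b \<circ> \<sigma>)) =
      ewens_weight \<theta> n \<sigma> * ((\<theta> * F \<sigma> + (\<Sum>b=1..n. F (Transposition.transpose (Suc n) b \<circ> \<sigma>))) / (\<theta> + real n))"
    by (simp only: 1) (simp add: add_divide_distrib distrib_left)
qed

lemma ewens_exp_cong:
  "(\<And>\<sigma>. \<sigma> permutes {1..n} \<Longrightarrow> F \<sigma> = G \<sigma>) \<Longrightarrow> ewens_exp \<theta> n F = ewens_exp \<theta> n G"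
  by (simp add: ewens_exp_def)

lemma ewens_cyc_start:
  assumes \<theta>: "\<theta> > 0"
  shows "ewens_cyc \<theta> (Suc n) (Suc n) g = ewens_p \<theta> (Suc n) * g 1"
proof -
  have "ewens_cyc \<theta> (Suc n) (Suc n) g = ewens_exp \<theta> n (\<lambda>\<sigma>. ewens_p \<theta> (Suc n) * g 1)"
    unfolding ewens_cyc_def ewens_exp_Suc[OF \<theta>]
  proof (rule ewens_exp_cong)
    fix \<sigma> assume \<sigma>: "\<sigma> permutes {1..n}"
    have "\<sigma> (Suc n) = Suc n" using \<sigma> by (simp add: permutes_not_in)
    then have "orbit \<sigma> (Suc n) = {Suc n}" by (simp add: orbit_eq_singleton_iff)
    moreover have "(\<Sum>b=1..n. if Suc n \<in> cycle_mins (Suc n) (Transposition.transpose (Suc n) b \<circ> \<sigma>)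
        then g (card (orbit (Transposition.transpose (Suc n) b \<circ> \<sigma>) (Suc n))) else 0) = 0"
      by (intro sum.neutral ballI) (simp only: cycle_mins_transpose_comp[OF \<sigma>] Suc_notin_cycle_mins if_False)
    ultimately show "(\<theta> * (if Suc n \<in> cycle_mins (Suc n) \<sigma> then g (card (orbit \<sigma> (Suc n))) else 0) +
        (\<Sum>b=1..n. if Suc n \<in> cycle_mins (Suc n) (Transposition.transpose (Suc n) b \<circ> \<sigma>)
        then g (card (orbit (Transposition.transpose (Suc n) b \<circ> \<sigma>) (Suc n))) else 0)) / (\<theta> + real n) =
        ewens_p \<theta> (Suc n) * g 1"
      by (simp add: cycle_mins_fixed[OF \<sigma>] ewens_p_def)
  qed
  also have "\<dots> = ewens_p \<theta> (Suc n) * g 1"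
    using sum_ewens_weight[OF \<theta>, of n] by (simp add: ewens_exp_def sum_distrib_right[symmetric])
  finally show ?thesis .
qed

text \<open>A cycle of length \<open>l\<close> receives the new element exactly when
  \<open>b\<close> is one of its \<open>l\<close> points, hence with probability
  \<open>l / (\<theta> + n)\<close>. The right-hand side is the resulting conditional mean of
  \<open>g\<close>; functions with a simple drift therefore satisfy closed recursions in
  \<open>n\<close>.\<close>

lemma ewens_cyc_Suc:
  assumes \<theta>: "\<theta> > 0" and i: "i \<in> {1..n}"
  shows "ewens_cyc \<theta> (Suc n) i g =
    ewens_cyc \<theta> n i (\<lambda>l. g l + real l * (g (Suc l) - g l) / (\<theta> + real n))"
  unfolding ewens_cyc_def ewens_exp_Suc[OF \<theta>]
proof (rule ewens_exp_cong)
  fix \<sigma> assume \<sigma>: "\<sigma> permutes {1..n}"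
  define l where "l = card (orbit \<sigma> i)"
  have sub: "orbit \<sigma> i \<subseteq> {1..n}" using permutes_orbit_subset[OF \<sigma> i] .
  have mem: "i \<in> cycle_mins (Suc n) \<sigma> \<longleftrightarrow> i \<in> cycle_mins n \<sigma>"
    using i by (auto simp: cycle_mins_fixed[OF \<sigma>])
  have ln: "l \<le> n" using card_mono[OF _ sub] by (simp add: l_def)
  show "(\<theta> * (if i \<in> cycle_mins (Suc n) \<sigma> then g (card (orbit \<sigma> i)) else 0) +
      (\<Sum>b=1..n. if i \<in> cycle_mins (Suc n) (Transposition.transpose (Suc n) b \<circ> \<sigma>)
        then g (card (orbit (Transposition.transpose (Suc n) b \<circ> \<sigma>) i)) else 0)) / (\<theta> + real n) =
      (if i \<in> cycle_mins n \<sigma> then g (card (orbit \<sigma> i)) + real (card (orbit \<sigma> i)) *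
        (g (Suc (card (orbit \<sigma> i))) - g (card (orbit \<sigma> i))) / (\<theta> + real n) else 0)"
  proof (cases "i \<in> cycle_mins n \<sigma>")
    case False
    have "(\<Sum>b=1..n. if i \<in> cycle_mins (Suc n) (Transposition.transpose (Suc n) b \<circ> \<sigma>)
        then g (card (orbit (Transposition.transpose (Suc n) b \<circ> \<sigma>) i)) else 0) = 0"
      by (intro sum.neutral ballI) (simp only: cycle_mins_transpose_comp[OF \<sigma>] False if_False)
    then show ?thesis using False mem by simp
  next
    case True
    have "(\<Sum>b=1..n. if i \<in> cycle_mins (Suc n) (Transposition.transpose (Suc n) b \<circ> \<sigma>)
        then g (card (orbit (Transposition.transpose (Suc n) b \<circ> \<sigma>) i)) else 0) =
        (\<Sum>b=1..n. if b \<in> orbit \<sigma> i then g (Suc l) else g l)"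
      by (intro sum.cong refl)
        (simp only: cycle_mins_transpose_comp[OF \<sigma>] True if_True
          card_orbit_transpose_comp[OF \<sigma> _ i] l_def[symmetric] if_distrib[of g])
    also have "\<dots> = real l * g (Suc l) + real (n - l) * g l"
    proof -
      have "{1..n} \<inter> {b. b \<in> orbit \<sigma> i} = orbit \<sigma> i" "{1..n} \<inter> - {b. b \<in> orbit \<sigma> i} = {1..n} - orbit \<sigma> i"
        using sub by auto
      moreover have "card ({1..n} - orbit \<sigma> i) = n - l"
        using card_Diff_subset[OF finite_subset[OF sub] sub] by (simp add: l_def)
      ultimately show ?thesis by (simp add: sum.If_cases l_def)
    qed
    finally have *: "(\<Sum>b=1..n. if i \<in> cycle_mins (Suc n) (Transposition.transpose (Suc n) b \<circ> \<sigma>)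
        then g (card (orbit (Transposition.transpose (Suc n) b \<circ> \<sigma>) i)) else 0) = real l * g (Suc l) + (real n - real l) * g l"
      using ln by (simp add: of_nat_diff)
    have "\<theta> + real n > 0" using \<theta> by simp
    then show ?thesis unfolding * mem using True
      by (simp add: l_def[symmetric] field_simps)
  qed
qed

section \<open>Mean deviation from a sum of independent variables\<close>

lemma ewens_cyc_linear:
  "ewens_cyc \<theta> n i (\<lambda>l. a * g l + b * h l) = a * ewens_cyc \<theta> n i g + b * ewens_cyc \<theta> n i h"
  unfolding ewens_cyc_def ewens_exp_cmult[symmetric] ewens_exp_add[symmetric]
  by (rule ewens_exp_cong) simp

lemma ewens_cyc_cong:
  assumes "\<And>l. l > 0 \<Longrightarrow> g l = h l"
  shows "ewens_cyc \<theta> n i g = ewens_cyc \<theta> n i h"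
  unfolding ewens_cyc_def
  by (rule ewens_exp_cong) (simp add: assms card_orbit_pos permutes_imp_permutation)

lemma ewens_cyc_mono:
  assumes "\<theta> > 0" "\<And>l. l > 0 \<Longrightarrow> g l \<le> h l"
  shows "ewens_cyc \<theta> n i g \<le> ewens_cyc \<theta> n i h"
  unfolding ewens_cyc_def
  by (rule ewens_exp_mono[OF assms(1)]) (simp add: assms(2) card_orbit_pos permutes_imp_permutation)

lemma ewens_cyc_one:
  assumes \<theta>: "\<theta> > 0" and "1 \<le> i" "i \<le> n"
  shows "ewens_cyc \<theta> n i (\<lambda>_. 1) = ewens_p \<theta> i"
  using \<open>i \<le> n\<close>
proof (induction n rule: dec_induct)
  case base
  then show ?case using ewens_cyc_start[OF \<theta>, of "i - 1"] \<open>1 \<le> i\<close> by simp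
next
  case (step n)
  then show ?case using ewens_cyc_Suc[OF \<theta>, of i n "\<lambda>_. 1"] \<open>1 \<le> i\<close> by simp
qed

text \<open>For the identity function the drift is a multiple of the length itself, so each step
  multiplies the mean by \<open>(\<theta> + n + 1) / (\<theta> + n)\<close>, and these factors
  telescope.\<close>

lemma ewens_cyc_length:
  assumes \<theta>: "\<theta> > 0" and "1 \<le> i" "i \<le> n"
  shows "ewens_cyc \<theta> n i real = ewens_p \<theta> i * ((\<theta> + real n) / (\<theta> + real i))"
  using \<open>i \<le> n\<close>
proof (induction n rule: dec_induct)
  case base
  then show ?case using ewens_cyc_start[OF \<theta>, of "i - 1" real] \<open>1 \<le> i\<close> \<theta> by simp
next
  case (step n)
  have pos: "\<theta> + real n > 0" "\<theta> + real i > 0" using \<theta> by simp_all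
  have "ewens_cyc \<theta> (Suc n) i real =
      ewens_cyc \<theta> n i (\<lambda>l. (1 + 1 / (\<theta> + real n)) * real l + 0 * real l)"
    using ewens_cyc_Suc[OF \<theta>, of i n real] step \<open>1 \<le> i\<close> by (simp add: distrib_right)
  also have "\<dots> = (1 + 1 / (\<theta> + real n)) * ewens_cyc \<theta> n i real"
    unfolding ewens_cyc_linear by simp
  also have "\<dots> = ewens_p \<theta> i * ((1 + 1 / (\<theta> + real n)) * (\<theta> + real n) / (\<theta> + real i))"
    using step.IH by simp
  also have "(1 + 1 / (\<theta> + real n)) * (\<theta> + real n) = \<theta> + real (Suc n)"
    using pos by (simp add: field_simps)
  finally show ?case .
qed

text \<open>The harmonic number replaces the logarithm because its increment from \<open>l\<close>
  to \<open>Suc l\<close> is exactly \<open>1 / l\<close>. This cancels the factor \<open>l\<close>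
  in the drift, so each step adds the same amount whatever the length.\<close>

lemma ewens_cyc_harm:
  assumes \<theta>: "\<theta> > 0" and "1 \<le> i" "i \<le> n"
  shows "ewens_cyc \<theta> n i (\<lambda>l. harm (l - 1)) = ewens_p \<theta> i * (\<Sum>m=i..<n. 1 / (\<theta> + real m))"
  using \<open>i \<le> n\<close>
proof (induction n rule: dec_induct)
  case base
  then show ?case using ewens_cyc_start[OF \<theta>, of "i - 1" "\<lambda>l. harm (l - 1)"] \<open>1 \<le> i\<close>
    by (simp add: harm_def)
next
  case (step n)
  have "ewens_cyc \<theta> (Suc n) i (\<lambda>l. harm (l - 1)) = ewens_cyc \<theta> n i
      (\<lambda>l. harm (l - 1) + real l * (harm (Suc l - 1) - harm (l - 1)) / (\<theta> + real n))"
    using ewens_cyc_Suc[OF \<theta>, of i n "\<lambda>l. harm (l - 1)"] step \<open>1 \<le> i\<close> by simp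
  also have "\<dots> = ewens_cyc \<theta> n i (\<lambda>l. 1 * harm (l - 1) + 1 / (\<theta> + real n) * 1)"
  proof (rule ewens_cyc_cong)
    fix l :: nat assume "l > 0"
    then obtain k where "l = Suc k" by (cases l) auto
    then show "harm (l - 1) + real l * (harm (Suc l - 1) - harm (l - 1)) / (\<theta> + real n) =
        1 * harm (l - 1) + 1 / (\<theta> + real n) * 1"
      by (simp add: harm_Suc del: of_nat_Suc)
  qed
  also have "\<dots> = ewens_cyc \<theta> n i (\<lambda>l. harm (l - 1)) + 1 / (\<theta> + real n) * ewens_p \<theta> i"
    unfolding ewens_cyc_linear using ewens_cyc_one[OF \<theta> \<open>1 \<le> i\<close>] step by simp
  also have "\<dots> = ewens_p \<theta> i * (\<Sum>m=i..<Suc n. 1 / (\<theta> + real m))"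
    using step by (simp add: algebra_simps)
  finally show ?case .
qed

text \<open>Transfers the exact mean of the harmonic number to a lower bound for the mean of the
  logarithm of the length.\<close>

lemma harm_le_ln_plus_1:
  assumes "l > 0"
  shows "harm (l - 1) \<le> ln (real l) + 1"
proof -
  have "harm (Suc m) \<le> ln (real (Suc m)) + (1::real)" for m
  proof (induction m)
    case (Suc m)
    have "ln (real (Suc m) / real (Suc (Suc m))) \<le> real (Suc m) / real (Suc (Suc m)) - 1"
      by (rule ln_le_minus_one) simp
    then have "inverse (real (Suc (Suc m))) \<le> ln (real (Suc (Suc m))) - ln (real (Suc m))"
      by (simp add: ln_div field_simps)
    with Suc show ?case unfolding harm_Suc[of "Suc m"] by linarith
  qed (simp add: harm_expand)
  moreover have "harm (l - 1) \<le> (harm (Suc (l - 1)) :: real)" by (rule harm_mono) simp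
  ultimately show ?thesis using assms by (metis Suc_pred' order_trans)
qed

lemma ln_ratio_le_sum_inverse:
  fixes \<theta> :: real
  assumes \<theta>: "\<theta> > 0" and "i \<le> n"
  shows "ln (\<theta> + real n) - ln (\<theta> + real i) \<le> (\<Sum>m=i..<n. 1 / (\<theta> + real m))"
  using \<open>i \<le> n\<close>
proof (induction n rule: dec_induct)
  case (step n)
  have pos: "\<theta> + real n > 0" using \<theta> by simp
  have "ln ((\<theta> + real (Suc n)) / (\<theta> + real n)) \<le> (\<theta> + real (Suc n)) / (\<theta> + real n) - 1"
    using pos by (intro ln_le_minus_one) simp
  also have "\<dots> = 1 / (\<theta> + real n)" using pos by (simp add: field_simps)
  also have "ln ((\<theta> + real (Suc n)) / (\<theta> + real n)) = ln (\<theta> + real (Suc n)) - ln (\<theta> + real n)"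
    using pos by (intro ln_divide_pos) simp_all
  finally show ?case using step by simp
qed simp

text \<open>With \<open>y = ln (l i / n)\<close>, where \<open>l\<close> is the cycle length, the estimate rests on
  \<open>\<bar>y\<bar> = 2 max y 0 - y\<close> and \<open>max y 0 \<le> exp y\<close>: only the first moment of \<open>l\<close>, for an
  upper bound, and the mean of its logarithm, for a lower bound, are needed.\<close>

lemma ewens_cyc_log_deviation:
  assumes \<theta>: "\<theta> > 0" and i: "1 \<le> i" "i \<le> n"
  shows "ewens_cyc \<theta> n i (\<lambda>l. \<bar>ln (real l) - ln (real n / real i)\<bar>) \<le> 3 * (1 + \<theta>) * ewens_p \<theta> i"
proof -
  define a where "a = ln (real n / real i)"
  define c where "c = real i / real n"
  define S where "S = (\<Sum>m=i..<n. 1 / (\<theta> + real m))"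
  have ni: "real n > 0" "real i > 0" using i by auto
  have exp_a: "exp (- a) = c" using ni by (simp add: a_def c_def exp_minus)
  have p: "ewens_p \<theta> i > 0" using ewens_p_pos[OF \<theta>] .
  \<comment> \<open>The majorant comes from \<open>\<bar>y\<bar> \<le> 2 * exp y - y\<close>, where
    \<open>exp y = c * l\<close>, and from \<open>- ln l \<le> 1 - harm (l - 1)\<close>. It is a
    combination of the three functions whose means are known exactly.\<close>
  have "ewens_cyc \<theta> n i (\<lambda>l. \<bar>ln (real l) - a\<bar>) \<le>
      ewens_cyc \<theta> n i (\<lambda>l. 1 * (2 * c * real l + (- 1) * harm (l - 1)) + (1 + a) * 1)"
  proof (rule ewens_cyc_mono[OF \<theta>])
    fix l :: nat assume l: "l > 0"
    define y where "y = ln (real l) - a"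
    have "exp y = c * real l" using l by (simp add: y_def exp_diff exp_a[symmetric] exp_minus field_simps)
    moreover have "\<bar>y\<bar> \<le> 2 * exp y - y" using exp_ge_add_one_self[of y] exp_ge_zero[of y] unfolding abs_real_def by (simp split: if_split; linarith)
    moreover have "harm (l - 1) \<le> ln (real l) + 1" using harm_le_ln_plus_1[OF l] .
    ultimately show "\<bar>ln (real l) - a\<bar> \<le> 1 * (2 * c * real l + (- 1) * harm (l - 1)) + (1 + a) * 1"
      unfolding y_def by simp
  qed
  also have "\<dots> = ewens_p \<theta> i * (2 * (c * ((\<theta> + real n) / (\<theta> + real i))) - S + (1 + a))"
    unfolding ewens_cyc_linear ewens_cyc_one[OF \<theta> i] ewens_cyc_length[OF \<theta> i] ewens_cyc_harm[OF \<theta> i] S_def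
    by (simp add: algebra_simps)
  \<comment> \<open>The length term contributes at most \<open>2 * (1 + \<theta>)\<close>, and
    \<open>a - S \<le> \<theta>\<close> bounds the rest by \<open>1 + \<theta>\<close>.\<close>
  also have "\<dots> \<le> ewens_p \<theta> i * (3 * (1 + \<theta>))"
  proof (rule mult_left_mono)
    have "c * ((\<theta> + real n) / (\<theta> + real i)) = (real i / (\<theta> + real i)) * ((\<theta> + real n) / real n)"
      by (simp add: c_def)
    also have "\<dots> \<le> 1 * (1 + \<theta>)"
    proof (rule mult_mono)
      have "\<theta> \<le> \<theta> * real n" using \<theta> i by simp
      then show "(\<theta> + real n) / real n \<le> 1 + \<theta>" using ni by (simp add: field_simps)
    qed (use \<theta> in simp_all)
    finally have 1: "c * ((\<theta> + real n) / (\<theta> + real i)) \<le> 1 + \<theta>" by simp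
    have "ln ((\<theta> + real i) / real i) \<le> (\<theta> + real i) / real i - 1"
      using \<theta> ni by (intro ln_le_minus_one) simp
    also have "\<dots> = \<theta> / real i" using ni by (simp add: field_simps)
    also have "\<dots> \<le> \<theta>" using \<theta> i by (simp add: field_simps)
    also have "ln ((\<theta> + real i) / real i) = ln (\<theta> + real i) - ln (real i)"
      using \<theta> ni by (intro ln_divide_pos) simp_all
    finally have "ln (\<theta> + real i) - ln (real i) \<le> \<theta>" .
    moreover have "ln (real n) \<le> ln (\<theta> + real n)" using \<theta> ni by simp
    moreover have "ln (\<theta> + real n) - ln (\<theta> + real i) \<le> S"
      unfolding S_def by (rule ln_ratio_le_sum_inverse[OF \<theta> i(2)])
    moreover have "a = ln (real n) - ln (real i)" using ni by (simp add: a_def ln_div)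
    ultimately have 2: "a - S \<le> \<theta>" by linarith
    show "2 * (c * ((\<theta> + real n) / (\<theta> + real i))) - S + (1 + a) \<le> 3 * (1 + \<theta>)"
      using 1 2 by argo
  qed (use p in simp)
  finally show ?thesis by (simp add: a_def mult_ac)
qed

section \<open>The mean number of cycles and the mean of K ln K\<close>

definition ewens_lambda :: "real \<Rightarrow> nat \<Rightarrow> real" where
  "ewens_lambda \<theta> n = (\<Sum>i=1..n. ewens_p \<theta> i)"

text \<open>The element 1 is always a minimum, so the first summand alone is 1. This keeps
  \<open>1 / m\<close> in the unit interval and \<open>ln m\<close> nonnegative below.\<close>

lemma ewens_lambda_ge_1:
  assumes \<theta>: "\<theta> > 0" and n: "n \<ge> 1"
  shows "ewens_lambda \<theta> n \<ge> 1"
proof -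
  have "ewens_p \<theta> 1 \<le> (\<Sum>i=1..n. ewens_p \<theta> i)"
    using n ewens_p_pos[OF \<theta>] by (intro member_le_sum) (auto intro: less_imp_le)
  then show ?thesis using \<theta> by (simp add: ewens_lambda_def ewens_p_def)
qed

lemma ewens_exp_card_cycle_mins:
  assumes \<theta>: "\<theta> > 0"
  shows "ewens_exp \<theta> n (\<lambda>\<sigma>. real (card (cycle_mins n \<sigma>))) = ewens_lambda \<theta> n"
proof -
  have "ewens_exp \<theta> n (\<lambda>\<sigma>. real (card (cycle_mins n \<sigma>))) =
      ewens_exp \<theta> n (\<lambda>\<sigma>. \<Sum>i=1..n. if i \<in> cycle_mins n \<sigma> then 1 else 0)"
  proof (rule ewens_exp_cong)
    fix \<sigma>
    have "{1..n} \<inter> {i. i \<in> cycle_mins n \<sigma>} = cycle_mins n \<sigma>" by (auto simp: cycle_mins_def)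
    then show "real (card (cycle_mins n \<sigma>)) = (\<Sum>i=1..n. if i \<in> cycle_mins n \<sigma> then 1 else 0)"
      by (simp add: sum.If_cases)
  qed
  also have "\<dots> = (\<Sum>i=1..n. ewens_cyc \<theta> n i (\<lambda>_. 1))"
    by (simp only: ewens_exp_sum ewens_cyc_def)
  also have "\<dots> = ewens_lambda \<theta> n"
    unfolding ewens_lambda_def by (intro sum.cong refl) (simp add: ewens_cyc_one[OF \<theta>])
  finally show ?thesis .
qed

text \<open>Scaling by the mean \<open>m\<close> makes the moment bounded uniformly in
  \<open>n\<close>: since \<open>exp x - 1 \<le> 2 * x\<close> on the unit interval, the product is
  at most \<open>exp\<close> of \<open>2 / m\<close> times the sum of the probabilities, and that
  sum is \<open>m\<close>.\<close>

lemma ewens_exp_exp_card_cycle_mins: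
  assumes \<theta>: "\<theta> > 0" and n: "n \<ge> 1"
  defines "m \<equiv> ewens_lambda \<theta> n"
  shows "ewens_exp \<theta> n (\<lambda>\<sigma>. exp (real (card (cycle_mins n \<sigma>)) / m)) \<le> exp 2"
proof -
  have m: "m \<ge> 1" using ewens_lambda_ge_1[OF \<theta> n] by (simp add: m_def)
  have "ewens_exp \<theta> n (\<lambda>\<sigma>. exp (real (card (cycle_mins n \<sigma>)) / m)) =
      (\<Sum>\<sigma> | \<sigma> permutes {1..n}. of_real (ewens_weight \<theta> n \<sigma>) * (\<Prod>i\<in>cycle_mins n \<sigma>. exp (1 / m)))"
    unfolding ewens_exp_def by (intro sum.cong refl) (simp add: exp_of_nat_mult[symmetric])
  also have "\<dots> = (\<Prod>i=1..n. 1 + ewens_p \<theta> i * (exp (1 / m) - 1))"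
    unfolding ewens_generating_function[OF \<theta>] by simp
  also have "\<dots> \<le> (\<Prod>i=1..n. exp (ewens_p \<theta> i * (2 / m)))"
  proof (rule prod_mono, safe)
    fix i
    have p: "ewens_p \<theta> i > 0" using ewens_p_pos[OF \<theta>] .
    show "0 \<le> 1 + ewens_p \<theta> i * (exp (1 / m) - 1)"
      using p m by (intro add_nonneg_nonneg mult_nonneg_nonneg) simp_all
    have "exp (1 / m) \<le> 1 + 1 / m + (1 / m)\<^sup>2" using m by (intro exp_bound) simp_all
    moreover have "(1 / m)\<^sup>2 \<le> 1 / m" using m by (simp add: power2_eq_square field_simps)
    ultimately have "exp (1 / m) - 1 \<le> 2 / m" by simp
    then have "1 + ewens_p \<theta> i * (exp (1 / m) - 1) \<le> 1 + ewens_p \<theta> i * (2 / m)"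
      using p by (intro add_left_mono mult_left_mono) simp_all
    also have "\<dots> \<le> exp (ewens_p \<theta> i * (2 / m))" by (rule exp_ge_add_one_self)
    finally show "1 + ewens_p \<theta> i * (exp (1 / m) - 1) \<le> exp (ewens_p \<theta> i * (2 / m))" .
  qed
  also have "\<dots> = exp (m * (2 / m))"
    by (simp only: exp_sum[OF finite_atLeastAtMost, symmetric] sum_distrib_right[symmetric] m_def ewens_lambda_def)
  also have "m * (2 / m) = 2" using m by simp
  finally show ?thesis .
qed

text \<open>From \<open>ln k \<le> ln m + k / m\<close> one gets a linear term in \<open>k\<close>
  and the square \<open>k * k / m\<close>. The square is \<open>2 * m\<close> times half the square
  of \<open>k / m\<close>, which lies below \<open>exp (k / m)\<close>, so the preceding exponential
  moment applies.\<close>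

lemma ewens_exp_cycles_log_cycles:
  assumes \<theta>: "\<theta> > 0" and n: "n \<ge> 1"
  defines "m \<equiv> ewens_lambda \<theta> n"
  shows "ewens_exp \<theta> n (\<lambda>\<sigma>. real (card (cycle_mins n \<sigma>)) * ln (real (card (cycle_mins n \<sigma>))))
    \<le> m * ln m + 2 * exp 2 * m"
proof -
  have m: "m \<ge> 1" using ewens_lambda_ge_1[OF \<theta> n] by (simp add: m_def)
  have "ewens_exp \<theta> n (\<lambda>\<sigma>. real (card (cycle_mins n \<sigma>)) * ln (real (card (cycle_mins n \<sigma>)))) \<le>
      ewens_exp \<theta> n (\<lambda>\<sigma>. ln m * real (card (cycle_mins n \<sigma>)) + 2 * m * exp (real (card (cycle_mins n \<sigma>)) / m))"
  proof (rule ewens_exp_mono[OF \<theta>])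
    fix \<sigma> assume "\<sigma> permutes {1..n}"
    define k where "k = real (card (cycle_mins n \<sigma>))"
    have k: "k \<ge> 1" using card_cycle_mins_pos[OF \<open>\<sigma> permutes {1..n}\<close> n] by (simp add: k_def)
    have "ln (k / m) \<le> k / m - 1" using k m by (intro ln_le_minus_one) simp
    then have "ln k \<le> ln m + k / m" using k m by (simp add: ln_div)
    then have "k * ln k \<le> k * (ln m + k / m)" using k by (intro mult_left_mono) simp_all
    also have "\<dots> = ln m * k + 2 * m * ((k / m)\<^sup>2 / 2)"
      using m by (simp add: power2_eq_square field_simps)
    also have "(k / m)\<^sup>2 / 2 \<le> exp (k / m)"
    proof -
      have "0 \<le> k / m" using k m by simp
      then show ?thesis using exp_lower_Taylor_quadratic[of "k / m"] by linarith
    qed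
    finally show "k * ln k \<le> ln m * k + 2 * m * exp (k / m)" using m by simp
  qed
  also have "\<dots> = m * ln m + 2 * m * ewens_exp \<theta> n (\<lambda>\<sigma>. exp (real (card (cycle_mins n \<sigma>)) / m))"
    by (simp add: ewens_exp_add ewens_exp_cmult ewens_exp_card_cycle_mins[OF \<theta>] m_def)
  also have "\<dots> \<le> m * ln m + 2 * m * exp 2"
    using ewens_exp_exp_card_cycle_mins[OF \<theta> n] m unfolding m_def[symmetric]
    by (intro add_left_mono mult_left_mono) simp_all
  finally show ?thesis by (simp add: mult_ac)
qed

text \<open>There are two errors: the gap K ln K between the bounds for \<open>invol\<close>, and
  the deviation of each log length from \<open>ln (n / i)\<close>, whose mean is at most a constant
  times \<open>ewens_p \<theta> i\<close>.\<close>

lemma ewens_exp_invol_deviation: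
  assumes \<theta>: "\<theta> > 0" and n: "n \<ge> 1"
  defines "m \<equiv> ewens_lambda \<theta> n"
  shows "ewens_exp \<theta> n (\<lambda>\<sigma>. \<bar>ln (real (invol n \<sigma>)) - (\<Sum>i\<in>cycle_mins n \<sigma>. ln (real n / real i))\<bar>)
    \<le> 3 * (1 + \<theta>) * m + (m * ln m + 2 * exp 2 * m)"
proof -
  let ?K = "\<lambda>\<sigma>. real (card (cycle_mins n \<sigma>))"
  let ?d = "\<lambda>i l. \<bar>ln (real l) - ln (real n / real i)\<bar>"
  have "ewens_exp \<theta> n (\<lambda>\<sigma>. \<bar>ln (real (invol n \<sigma>)) - (\<Sum>i\<in>cycle_mins n \<sigma>. ln (real n / real i))\<bar>) \<le>
      ewens_exp \<theta> n (\<lambda>\<sigma>. (\<Sum>i=1..n. if i \<in> cycle_mins n \<sigma> then ?d i (card (orbit \<sigma> i)) else 0) + ?K \<sigma> * ln (?K \<sigma>))"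
  proof (rule ewens_exp_mono[OF \<theta>])
    fix \<sigma> assume \<sigma>: "\<sigma> permutes {1..n}"
    define M where "M = cycle_mins n \<sigma>"
    have M: "{1..n} \<inter> {i. i \<in> M} = M" by (auto simp: M_def cycle_mins_def)
    have "\<bar>(\<Sum>i\<in>M. ln (real (card (orbit \<sigma> i)))) - (\<Sum>i\<in>M. ln (real n / real i))\<bar> \<le>
        (\<Sum>i\<in>M. ?d i (card (orbit \<sigma> i)))"
      unfolding sum_subtractf[symmetric] by (rule sum_abs)
    also have "\<dots> = (\<Sum>i=1..n. if i \<in> M then ?d i (card (orbit \<sigma> i)) else 0)"
      using M by (simp add: sum.If_cases)
    finally show "\<bar>ln (real (invol n \<sigma>)) - (\<Sum>i\<in>M. ln (real n / real i))\<bar> \<le>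
        (\<Sum>i=1..n. if i \<in> M then ?d i (card (orbit \<sigma> i)) else 0) + real (card M) * ln (real (card M))"
      using ln_invol_bounds[OF \<sigma>, folded M_def] by linarith
  qed
  also have "\<dots> = (\<Sum>i=1..n. ewens_cyc \<theta> n i (?d i)) + ewens_exp \<theta> n (\<lambda>\<sigma>. ?K \<sigma> * ln (?K \<sigma>))"
    by (simp only: ewens_exp_add ewens_exp_sum ewens_cyc_def)
  also have "\<dots> \<le> (\<Sum>i=1..n. 3 * (1 + \<theta>) * ewens_p \<theta> i) + (m * ln m + 2 * exp 2 * m)"
  proof (rule add_mono)
    show "(\<Sum>i=1..n. ewens_cyc \<theta> n i (?d i)) \<le> (\<Sum>i=1..n. 3 * (1 + \<theta>) * ewens_p \<theta> i)"
      by (intro sum_mono ewens_cyc_log_deviation[OF \<theta>]) simp_all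
    show "ewens_exp \<theta> n (\<lambda>\<sigma>. ?K \<sigma> * ln (?K \<sigma>)) \<le> m * ln m + 2 * exp 2 * m"
      unfolding m_def by (rule ewens_exp_cycles_log_cycles[OF \<theta> n])
  qed
  also have "(\<Sum>i=1..n. 3 * (1 + \<theta>) * ewens_p \<theta> i) = 3 * (1 + \<theta>) * m"
    by (simp add: sum_distrib_left[symmetric] m_def ewens_lambda_def)
  finally show ?thesis .
qed

section \<open>Asymptotics of the normalising sequences\<close>

text \<open>The difference telescopes into a convergent series. Any exponent below -1 would do; -3/2
  leaves room for powers of the logarithm over the square of \<open>n\<close>.\<close>

lemma partial_sums_minus_primitive_bounded:
  fixes f F :: "nat \<Rightarrow> real"
  assumes "(\<lambda>n. F (Suc n) - F n - f (Suc n)) \<in> O(\<lambda>n. real n powr (-3/2))"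
  shows "\<exists>C>0. \<forall>n. \<bar>(\<Sum>k=1..n. f k) - F n\<bar> \<le> C"
proof -
  define d where "d n = F (Suc n) - F n - f (Suc n)" for n
  have "summable (\<lambda>n. real n powr (-3/2))" by (subst summable_real_powr_iff) simp
  moreover have "norm (real n powr (-3/2)) = real n powr (-3/2)" for n by simp
  ultimately have "summable (\<lambda>n. norm (real n powr (-3/2)))" by (simp only:)
  moreover have "d \<in> O(\<lambda>n. real n powr (-3/2))" unfolding d_def by (rule assms)
  ultimately have "summable d" by (rule summable_comparison_test_bigo)
  then have "Bseq (\<lambda>n. sum d {..<n})"
    by (simp only: summable_iff_convergent convergent_imp_Bseq)
  then obtain K where K: "K > 0" "\<And>n. \<bar>sum d {..<n}\<bar> \<le> K"
    unfolding Bseq_def by auto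
  have eq: "(\<Sum>k=1..n. f k) - F n = - F 0 - sum d {..<n}" for n
    by (induction n) (simp_all add: d_def)
  have "\<bar>(\<Sum>k=1..n. f k) - F n\<bar> \<le> K + \<bar>F 0\<bar>" for n
    unfolding eq using K(2)[of n] by linarith
  with K(1) show ?thesis by (intro exI[of _ "K + \<bar>F 0\<bar>"]) (auto intro: add_pos_nonneg)
qed

text \<open>Powers of the logarithm serve as discrete primitives. The third sum is needed only to
  bound \<open>ewens_sigma\<close> from below; the first two show that the moments of the Bernoulli
  sum match the given normalisation.\<close>

lemma log_power_sums:
  obtains C :: real where "C > 0"
    and "\<And>n. \<bar>(\<Sum>k=1..n. 1 / real k) - ln (real n)\<bar> \<le> C"
    and "\<And>n. \<bar>(\<Sum>k=1..n. ln (real k) / real k) - (ln (real n))\<^sup>2 / 2\<bar> \<le> C"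
    and "\<And>n. \<bar>(\<Sum>k=1..n. (ln (real k))\<^sup>2 / real k) - (ln (real n)) ^ 3 / 3\<bar> \<le> C"
proof -
  have "(\<lambda>n. ln (real (Suc n)) - ln (real n) - 1 / real (Suc n)) \<in> O(\<lambda>n. real n powr (-3/2))"
    unfolding power2_eq_square power3_eq_cube by real_asymp
  from partial_sums_minus_primitive_bounded[where F="\<lambda>n. ln (real n)" and f="\<lambda>n. 1 / real n", OF this]
  obtain C0 where C0: "C0 > 0" "\<And>n. \<bar>(\<Sum>k=1..n. 1 / real k) - ln (real n)\<bar> \<le> C0" by blast
  have "(\<lambda>n. (ln (real (Suc n)))\<^sup>2 / 2 - (ln (real n))\<^sup>2 / 2 - ln (real (Suc n)) / real (Suc n))
      \<in> O(\<lambda>n. real n powr (-3/2))"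
    unfolding power2_eq_square power3_eq_cube by real_asymp
  from partial_sums_minus_primitive_bounded[where F="\<lambda>n. (ln (real n))\<^sup>2 / 2" and f="\<lambda>n. ln (real n) / real n", OF this]
  obtain C1 where C1: "C1 > 0" "\<And>n. \<bar>(\<Sum>k=1..n. ln (real k) / real k) - (ln (real n))\<^sup>2 / 2\<bar> \<le> C1"
    by blast
  have "(\<lambda>n. (ln (real (Suc n))) ^ 3 / 3 - (ln (real n)) ^ 3 / 3 - (ln (real (Suc n)))\<^sup>2 / real (Suc n))
      \<in> O(\<lambda>n. real n powr (-3/2))"
    unfolding power2_eq_square power3_eq_cube by real_asymp
  from partial_sums_minus_primitive_bounded[where F="\<lambda>n. (ln (real n)) ^ 3 / 3" and f="\<lambda>n. (ln (real n))\<^sup>2 / real n", OF this]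
  obtain C2 where C2: "C2 > 0" "\<And>n. \<bar>(\<Sum>k=1..n. (ln (real k))\<^sup>2 / real k) - (ln (real n)) ^ 3 / 3\<bar> \<le> C2"
    by blast
  show ?thesis
    by (rule that[of "max C0 (max C1 C2)"]) (use C0 C1 C2 in \<open>simp_all add: le_max_iff_disj\<close>)
qed

section \<open>Replacing \<open>ewens_p \<theta> i\<close> by \<open>\<theta> / i\<close>\<close>

lemma sum_inverse_squares_le: "(\<Sum>i=1..n. 1 / (real i)\<^sup>2) \<le> 2"
proof -
  have "(\<Sum>i=1..n. 1 / (real i)\<^sup>2) \<le> 2 - 1 / real n" if "n \<ge> 1"
    using that
  proof (induction n rule: dec_induct)
    case (step n)
    have n: "real n > 0" using step by simp
    have "1 / (real (Suc n))\<^sup>2 \<le> 1 / (real n * real (Suc n))"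
      using n by (intro divide_left_mono) (simp_all add: power2_eq_square)
    also have "\<dots> = 1 / real n - 1 / real (Suc n)" using n by (simp add: field_simps)
    finally show ?case using step by simp
  qed simp
  then show ?thesis by (cases "n \<ge> 1") (auto intro: order_trans)
qed

text \<open>The constant \<open>max 1 \<theta>\<close> covers both cases:
  \<open>\<theta> / i\<close> is an upper bound for \<open>\<theta> \<ge> 1\<close>, and
  \<open>1 / i\<close> for smaller \<open>\<theta>\<close>. The difference in the second claim is
  exactly \<open>ewens_p \<theta> i * (1 - \<theta>) / i\<close>, hence summable.\<close>

lemma ewens_p_bounds:
  assumes \<theta>: "\<theta> > 0" and i: "i \<ge> 1"
  shows "ewens_p \<theta> i \<le> max 1 \<theta> / real i"
    and "\<bar>ewens_p \<theta> i - \<theta> / real i\<bar> \<le> max 1 \<theta> * \<bar>1 - \<theta>\<bar> / (real i)\<^sup>2"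
proof -
  have i': "real i \<ge> 1" "real (i - 1) = real i - 1" using i by (simp_all add: of_nat_diff)
  have pos: "\<theta> + real i - 1 > 0" using \<theta> i' by linarith
  have key: "\<theta> * real i \<le> max 1 \<theta> * (\<theta> + real i - 1)"
  proof (cases "\<theta> \<ge> 1")
    case True
    then show ?thesis by (simp add: max_def)
  next
    case False
    have "0 \<le> (1 - \<theta>) * (real i - 1)" using False i' by simp
    then show ?thesis using False by (simp add: max_def algebra_simps)
  qed
  have p: "ewens_p \<theta> i = \<theta> / (\<theta> + real i - 1)" by (simp only: ewens_p_def i'(2) add_diff_eq)
  show *: "ewens_p \<theta> i \<le> max 1 \<theta> / real i"
    unfolding p using key pos i' by (subst frac_le_eq) (simp_all add: divide_le_0_iff mult_ac)
  have "ewens_p \<theta> i - \<theta> / real i = ewens_p \<theta> i * ((1 - \<theta>) / real i)"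
    unfolding p using pos i' by (simp add: field_simps)
  then have "\<bar>ewens_p \<theta> i - \<theta> / real i\<bar> = ewens_p \<theta> i * (\<bar>1 - \<theta>\<bar> / real i)"
    using ewens_p_pos[OF \<theta>, of i] i' by (simp add: abs_mult)
  also have "\<dots> \<le> max 1 \<theta> / real i * (\<bar>1 - \<theta>\<bar> / real i)"
    using * i' by (intro mult_right_mono) simp_all
  finally show "\<bar>ewens_p \<theta> i - \<theta> / real i\<bar> \<le> max 1 \<theta> * \<bar>1 - \<theta>\<bar> / (real i)\<^sup>2"
    by (simp add: power2_eq_square)
qed

lemma sum_ewens_p_squared_le:
  assumes \<theta>: "\<theta> > 0"
  shows "(\<Sum>i=1..n. (ewens_p \<theta> i)\<^sup>2) \<le> (max 1 \<theta>)\<^sup>2 * 2"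
proof -
  have "(\<Sum>i=1..n. (ewens_p \<theta> i)\<^sup>2) \<le> (\<Sum>i=1..n. (max 1 \<theta>)\<^sup>2 * (1 / (real i)\<^sup>2))"
  proof (rule sum_mono)
    fix i assume "i \<in> {1..n}"
    then have "(ewens_p \<theta> i)\<^sup>2 \<le> (max 1 \<theta> / real i)\<^sup>2"
      using ewens_p_bounds(1)[OF \<theta>, of i] ewens_p_pos[OF \<theta>, of i] by (intro power_mono) simp_all
    then show "(ewens_p \<theta> i)\<^sup>2 \<le> (max 1 \<theta>)\<^sup>2 * (1 / (real i)\<^sup>2)"
      by (simp add: power_divide)
  qed
  also have "\<dots> \<le> (max 1 \<theta>)\<^sup>2 * 2"
    unfolding sum_distrib_left[symmetric] using sum_inverse_squares_le by (intro mult_left_mono) simp_all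
  finally show ?thesis .
qed

text \<open>The bound \<open>B\<close> will be \<open>ln n\<close> for the mean and its square for
  the second moment; both are of smaller order than the standard deviation and the variance
  respectively.\<close>

lemma sum_ewens_p_approx:
  fixes g :: "nat \<Rightarrow> real"
  assumes \<theta>: "\<theta> > 0" and B: "0 \<le> B" and g: "\<And>i. 1 \<le> i \<Longrightarrow> i \<le> n \<Longrightarrow> \<bar>g i\<bar> \<le> B"
  shows "\<bar>(\<Sum>i=1..n. ewens_p \<theta> i * g i) - (\<Sum>i=1..n. \<theta> / real i * g i)\<bar> \<le> max 1 \<theta> * \<bar>1 - \<theta>\<bar> * B * 2"
proof -
  have "\<bar>(\<Sum>i=1..n. ewens_p \<theta> i * g i) - (\<Sum>i=1..n. \<theta> / real i * g i)\<bar> =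
      \<bar>\<Sum>i=1..n. (ewens_p \<theta> i - \<theta> / real i) * g i\<bar>"
    by (simp add: sum_subtractf left_diff_distrib)
  also have "\<dots> \<le> (\<Sum>i=1..n. \<bar>(ewens_p \<theta> i - \<theta> / real i) * g i\<bar>)" by (rule sum_abs)
  also have "\<dots> \<le> (\<Sum>i=1..n. max 1 \<theta> * \<bar>1 - \<theta>\<bar> * B * (1 / (real i)\<^sup>2))"
  proof (rule sum_mono)
    fix i assume i: "i \<in> {1..n}"
    have "\<bar>(ewens_p \<theta> i - \<theta> / real i) * g i\<bar> \<le> max 1 \<theta> * \<bar>1 - \<theta>\<bar> / (real i)\<^sup>2 * B"
      unfolding abs_mult using i ewens_p_bounds(2)[OF \<theta>, of i] g[of i] by (intro mult_mono) simp_all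
    then show "\<bar>(ewens_p \<theta> i - \<theta> / real i) * g i\<bar> \<le> max 1 \<theta> * \<bar>1 - \<theta>\<bar> * B * (1 / (real i)\<^sup>2)"
      by (simp add: mult_ac)
  qed
  also have "\<dots> \<le> max 1 \<theta> * \<bar>1 - \<theta>\<bar> * B * 2"
    unfolding sum_distrib_left[symmetric] using sum_inverse_squares_le B by (intro mult_left_mono) simp_all
  finally show ?thesis .
qed

section \<open>Growth of the standard deviation and comparison of moments\<close>

lemma filterlim_ln_nat: "filterlim (\<lambda>n. ln (real n)) at_top sequentially"
  by (rule filterlim_compose[OF ln_at_top filterlim_real_sequentially])

lemma ewens_sigma_squared: "\<theta> > 0 \<Longrightarrow>
    (ewens_sigma \<theta> n)\<^sup>2 = \<theta> * (\<Sum>k=1..n. (ln (real k))\<^sup>2 / real k)"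
  unfolding ewens_sigma_def
  by (subst real_sqrt_pow2) (auto simp: sum_distrib_left intro!: sum_nonneg)

text \<open>The leading coefficient is \<open>\<theta> / 3\<close>; half of it is given up to absorb
  the bounded error \<open>C\<close> once the cube of \<open>ln n\<close> exceeds
  \<open>6 * C\<close>. The explicit bound turns later limits into limits of elementary
  functions.\<close>

lemma ewens_sigma_lower:
  assumes \<theta>: "\<theta> > 0"
  shows "\<forall>\<^sub>F n in sequentially. 0 < \<theta> / 6 * (ln (real n)) ^ 3 \<and>
    sqrt (\<theta> / 6 * (ln (real n)) ^ 3) \<le> ewens_sigma \<theta> n"
proof -
  obtain C where C: "C > 0"
    "\<And>n. \<bar>(\<Sum>k=1..n. (ln (real k))\<^sup>2 / real k) - (ln (real n)) ^ 3 / 3\<bar> \<le> C"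
    using log_power_sums by metis
  have "filterlim (\<lambda>n. (ln (real n)) ^ 3) at_top sequentially"
    by (rule filterlim_pow_at_top[OF _ filterlim_ln_nat]) simp
  then have "\<forall>\<^sub>F n in sequentially. 6 * C \<le> (ln (real n)) ^ 3"
    by (simp add: filterlim_at_top)
  then show ?thesis
  proof eventually_elim
    case (elim n)
    have "(ln (real n)) ^ 3 / 6 \<le> (\<Sum>k=1..n. (ln (real k))\<^sup>2 / real k)"
      using C(2)[of n] elim by linarith
    then have "\<theta> * ((ln (real n)) ^ 3 / 6) \<le> (ewens_sigma \<theta> n)\<^sup>2"
      unfolding ewens_sigma_squared[OF \<theta>] using \<theta> by (intro mult_left_mono) simp_all
    moreover have "0 \<le> ewens_sigma \<theta> n"
      unfolding ewens_sigma_def using \<theta> by (intro real_sqrt_ge_zero sum_nonneg) simp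
    ultimately have "sqrt (\<theta> / 6 * (ln (real n)) ^ 3) \<le> ewens_sigma \<theta> n"
      by (intro real_le_lsqrt) simp_all
    moreover have "(ln (real n)) ^ 3 > 0" using elim C(1) by linarith
    ultimately show ?case using \<theta> by simp
  qed
qed

lemma tendsto_div_ewens_sigma:
  fixes u f :: "nat \<Rightarrow> real"
  assumes \<theta>: "\<theta> > 0" and bound: "\<forall>\<^sub>F n in sequentially. \<bar>u n\<bar> \<le> f n"
    and lim: "(\<lambda>n. f n / sqrt (\<theta> / 6 * (ln (real n)) ^ 3)) \<longlonglongrightarrow> 0"
  shows "(\<lambda>n. u n / ewens_sigma \<theta> n) \<longlonglongrightarrow> 0"
proof (rule Lim_null_comparison[OF _ lim])
  show "\<forall>\<^sub>F n in sequentially. norm (u n / ewens_sigma \<theta> n) \<le> f n / sqrt (\<theta> / 6 * (ln (real n)) ^ 3)"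
    using bound ewens_sigma_lower[OF \<theta>]
  proof eventually_elim
    case (elim n)
    then have "0 < sqrt (\<theta> / 6 * (ln (real n)) ^ 3)" by simp
    then have "\<bar>u n\<bar> / ewens_sigma \<theta> n \<le> f n / sqrt (\<theta> / 6 * (ln (real n)) ^ 3)"
      using elim by (intro frac_le) auto
    moreover have "0 < ewens_sigma \<theta> n" using elim \<open>0 < sqrt _\<close> by linarith
    ultimately show ?case by simp
  qed
qed

lemma tendsto_div_ewens_sigma_squared:
  fixes u f :: "nat \<Rightarrow> real"
  assumes \<theta>: "\<theta> > 0" and bound: "\<And>n. n \<ge> 1 \<Longrightarrow> \<bar>u n\<bar> \<le> f n"
    and lim: "(\<lambda>n. f n / (\<theta> / 6 * (ln (real n)) ^ 3)) \<longlonglongrightarrow> 0"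
  shows "(\<lambda>n. u n / (ewens_sigma \<theta> n)\<^sup>2) \<longlonglongrightarrow> 0"
proof (rule Lim_null_comparison[OF _ lim])
  show "\<forall>\<^sub>F n in sequentially. norm (u n / (ewens_sigma \<theta> n)\<^sup>2) \<le> f n / (\<theta> / 6 * (ln (real n)) ^ 3)"
    using ewens_sigma_lower[OF \<theta>] eventually_ge_at_top[of 1]
  proof eventually_elim
    case (elim n)
    then have "(sqrt (\<theta> / 6 * (ln (real n)) ^ 3))\<^sup>2 \<le> (ewens_sigma \<theta> n)\<^sup>2"
      by (intro power_mono) simp_all
    moreover have "(sqrt (\<theta> / 6 * (ln (real n)) ^ 3))\<^sup>2 = \<theta> / 6 * (ln (real n)) ^ 3"
      using elim by (intro real_sqrt_pow2) simp
    ultimately have "\<theta> / 6 * (ln (real n)) ^ 3 \<le> (ewens_sigma \<theta> n)\<^sup>2" by simp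
    then have "\<bar>u n\<bar> / (ewens_sigma \<theta> n)\<^sup>2 \<le> f n / (\<theta> / 6 * (ln (real n)) ^ 3)"
      using elim bound[of n] by (intro frac_le) auto
    then show ?case by simp
  qed
qed

text \<open>Each summand of the Bernoulli sum is at most \<open>ln n\<close>, so this is the uniform
  smallness condition of the central limit theorem.\<close>

lemma ln_div_ewens_sigma_tendsto:
  assumes \<theta>: "\<theta> > 0"
  shows "(\<lambda>n. ln (real n) / ewens_sigma \<theta> n) \<longlonglongrightarrow> 0"
proof (rule tendsto_div_ewens_sigma[OF \<theta>])
  show "\<forall>\<^sub>F n in sequentially. \<bar>ln (real n)\<bar> \<le> ln (real n)"
    using eventually_ge_at_top[of 1] by eventually_elim simp
  show "(\<lambda>n. ln (real n) / sqrt (\<theta> / 6 * (ln (real n)) ^ 3)) \<longlonglongrightarrow> 0"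
    using \<theta> by real_asymp
qed

lemma ln_ratio_bounds:
  assumes "1 \<le> i" "i \<le> n"
  shows "0 \<le> ln (real n / real i)" "ln (real n / real i) \<le> ln (real n)"
    "ln (real n / real i) = ln (real n) - ln (real i)"
proof -
  have i: "real i \<ge> 1" "real n \<ge> real i" using assms by simp_all
  show eq: "ln (real n / real i) = ln (real n) - ln (real i)" using i by (intro ln_divide_pos) simp_all
  show "0 \<le> ln (real n / real i)" "ln (real n / real i) \<le> ln (real n)" unfolding eq using i by simp_all
qed

text \<open>With \<open>L = ln n\<close> and the sums \<open>a\<close> of \<open>1 / k\<close> and
  \<open>b\<close> of \<open>ln k / k\<close>, the mean is about
  \<open>\<theta> * (L * a - b)\<close>. Up to order \<open>L\<close> this equals
  \<open>\<theta> * b = ewens_mu \<theta> n\<close>, because \<open>a\<close> is about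
  \<open>L\<close> and \<open>b\<close> is about half of \<open>L * L\<close>. So weights
  \<open>ln (n / k)\<close> and \<open>ln k\<close> give the same centring.\<close>

lemma ewens_mean_tendsto:
  assumes \<theta>: "\<theta> > 0"
  shows "(\<lambda>n. ((\<Sum>i=1..n. ewens_p \<theta> i * ln (real n / real i)) - ewens_mu \<theta> n) / ewens_sigma \<theta> n) \<longlonglongrightarrow> 0"
proof -
  obtain C where C: "C > 0"
    and h0: "\<And>n. \<bar>(\<Sum>k=1..n. 1 / real k) - ln (real n)\<bar> \<le> C"
    and h1: "\<And>n. \<bar>(\<Sum>k=1..n. ln (real k) / real k) - (ln (real n))\<^sup>2 / 2\<bar> \<le> C"
    using log_power_sums by metis
  define D where "D = max 1 \<theta> * \<bar>1 - \<theta>\<bar>"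
  define f where "f L = D * L * 2 + \<theta> * (C * L + 2 * C)" for L
  have bound: "\<bar>(\<Sum>i=1..n. ewens_p \<theta> i * ln (real n / real i)) - ewens_mu \<theta> n\<bar> \<le> f (ln (real n))"
    if n: "n \<ge> 1" for n
  proof -
    define L where "L = ln (real n)"
    define a where "a = (\<Sum>k=1..n. 1 / real k)"
    define b where "b = (\<Sum>k=1..n. ln (real k) / real k)"
    have L: "L \<ge> 0" using n by (simp add: L_def)
    have "(\<Sum>i=1..n. \<theta> / real i * ln (real n / real i)) = (\<Sum>i=1..n. \<theta> * (L * (1 / real i) - ln (real i) / real i))"
      by (intro sum.cong refl) (simp add: ln_ratio_bounds(3) L_def diff_divide_distrib right_diff_distrib)
    also have "\<dots> = \<theta> * (L * a - b)"
      by (simp only: sum_distrib_left[symmetric] sum_subtractf a_def b_def)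
    finally have 1: "(\<Sum>i=1..n. \<theta> / real i * ln (real n / real i)) = \<theta> * (L * a - b)" .
    have 2: "ewens_mu \<theta> n = \<theta> * b" by (simp add: ewens_mu_def b_def sum_distrib_left)
    have "\<bar>L * (a - L)\<bar> \<le> L * C" unfolding abs_mult using L h0[of n]
      by (intro mult_mono) (simp_all add: a_def L_def)
    moreover have "L * a - b - b = L * (a - L) - 2 * (b - L\<^sup>2 / 2)" by (simp add: algebra_simps power2_eq_square)
    ultimately have "\<bar>L * a - b - b\<bar> \<le> C * L + 2 * C"
      using h1[of n, folded L_def b_def] by (simp add: mult.commute)
    then have "\<theta> * \<bar>L * a - b - b\<bar> \<le> \<theta> * (C * L + 2 * C)" using \<theta> by (intro mult_left_mono) simp_all
    then have 3: "\<bar>\<theta> * (L * a - b) - \<theta> * b\<bar> \<le> \<theta> * (C * L + 2 * C)"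
      using \<theta> by (simp add: abs_mult right_diff_distrib[symmetric])
    have "\<bar>(\<Sum>i=1..n. ewens_p \<theta> i * ln (real n / real i)) - (\<Sum>i=1..n. \<theta> / real i * ln (real n / real i))\<bar> \<le> D * L * 2"
      unfolding D_def using L ln_ratio_bounds(1,2) by (intro sum_ewens_p_approx[OF \<theta>]) (simp_all add: L_def)
    then show ?thesis unfolding 1 2 f_def L_def[symmetric] using 3 by linarith
  qed
  show ?thesis
  proof (rule tendsto_div_ewens_sigma[OF \<theta>])
    show "\<forall>\<^sub>F n in sequentially. \<bar>(\<Sum>i=1..n. ewens_p \<theta> i * ln (real n / real i)) - ewens_mu \<theta> n\<bar> \<le> f (ln (real n))"
      using eventually_ge_at_top[of 1] by eventually_elim (rule bound)
    have l1: "(\<lambda>n. ln (real n) / sqrt (\<theta> / 6 * (ln (real n)) ^ 3)) \<longlonglongrightarrow> 0"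
      and l2: "(\<lambda>n. 1 / sqrt (\<theta> / 6 * (ln (real n)) ^ 3)) \<longlonglongrightarrow> 0" using \<theta> by real_asymp+
    have "(\<lambda>n. (D * 2 + \<theta> * C) * (ln (real n) / sqrt (\<theta> / 6 * (ln (real n)) ^ 3))
        + \<theta> * 2 * C * (1 / sqrt (\<theta> / 6 * (ln (real n)) ^ 3))) \<longlonglongrightarrow> (D * 2 + \<theta> * C) * 0 + \<theta> * 2 * C * 0"
      by (intro tendsto_add tendsto_mult tendsto_const l1 l2)
    then show "(\<lambda>n. f (ln (real n)) / sqrt (\<theta> / 6 * (ln (real n)) ^ 3)) \<longlonglongrightarrow> 0"
      by (simp add: f_def add_divide_distrib algebra_simps)
  qed
qed

text \<open>Expanding the square of \<open>L - ln i\<close> gives three sums; the two that involve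
  \<open>L\<close> cancel to leading order, and the third is exactly the variance of the
  normalisation. The Bernoulli factors \<open>1 - p\<close> are omitted, since the later Poisson
  approximation produces precisely this second moment.\<close>

lemma ewens_variance_tendsto:
  assumes \<theta>: "\<theta> > 0"
  shows "(\<lambda>n. (\<Sum>i=1..n. ewens_p \<theta> i * (ln (real n / real i))\<^sup>2) / (ewens_sigma \<theta> n)\<^sup>2) \<longlonglongrightarrow> 1"
proof -
  obtain C where C: "C > 0"
    and h0: "\<And>n. \<bar>(\<Sum>k=1..n. 1 / real k) - ln (real n)\<bar> \<le> C"
    and h1: "\<And>n. \<bar>(\<Sum>k=1..n. ln (real k) / real k) - (ln (real n))\<^sup>2 / 2\<bar> \<le> C"
    using log_power_sums by metis
  define D where "D = max 1 \<theta> * \<bar>1 - \<theta>\<bar>"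
  define f where "f L = D * L\<^sup>2 * 2 + \<theta> * (C * L\<^sup>2 + 2 * C * L)" for L
  have bound: "\<bar>(\<Sum>i=1..n. ewens_p \<theta> i * (ln (real n / real i))\<^sup>2) - (ewens_sigma \<theta> n)\<^sup>2\<bar> \<le> f (ln (real n))"
    if n: "n \<ge> 1" for n
  proof -
    define L where "L = ln (real n)"
    define a where "a = (\<Sum>k=1..n. 1 / real k)"
    define b where "b = (\<Sum>k=1..n. ln (real k) / real k)"
    define c where "c = (\<Sum>k=1..n. (ln (real k))\<^sup>2 / real k)"
    have L: "L \<ge> 0" using n by (simp add: L_def)
    have "(\<Sum>i=1..n. \<theta> / real i * (ln (real n / real i))\<^sup>2) =
        (\<Sum>i=1..n. \<theta> * (L\<^sup>2 * (1 / real i) - 2 * L * (ln (real i) / real i) + (ln (real i))\<^sup>2 / real i))"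
    proof (intro sum.cong refl)
      fix i assume "i \<in> {1..n}"
      then have i: "real i > 0" and eq: "ln (real n / real i) = L - ln (real i)"
        using ln_ratio_bounds(3)[of i n] by (simp_all add: L_def)
      show "\<theta> / real i * (ln (real n / real i))\<^sup>2 =
          \<theta> * (L\<^sup>2 * (1 / real i) - 2 * L * (ln (real i) / real i) + (ln (real i))\<^sup>2 / real i)"
        unfolding eq using i by (simp add: power2_diff field_simps)
    qed
    also have "\<dots> = \<theta> * (L\<^sup>2 * a - 2 * L * b + c)"
      by (simp only: sum_distrib_left[symmetric] sum_subtractf sum.distrib a_def b_def c_def)
    finally have 1: "(\<Sum>i=1..n. \<theta> / real i * (ln (real n / real i))\<^sup>2) = \<theta> * (L\<^sup>2 * a - 2 * L * b + c)" .
    have 2: "(ewens_sigma \<theta> n)\<^sup>2 = \<theta> * c" unfolding ewens_sigma_squared[OF \<theta>] c_def ..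
    have "\<bar>L\<^sup>2 * (a - L)\<bar> \<le> L\<^sup>2 * C" unfolding abs_mult using L h0[of n]
      by (intro mult_mono) (simp_all add: a_def L_def)
    moreover have "\<bar>2 * L * (b - L\<^sup>2 / 2)\<bar> \<le> 2 * L * C" unfolding abs_mult using L h1[of n]
      by (intro mult_mono) (simp_all add: b_def L_def)
    moreover have "L\<^sup>2 * a - 2 * L * b = L\<^sup>2 * (a - L) - 2 * L * (b - L\<^sup>2 / 2)"
      by (simp add: algebra_simps power2_eq_square)
    ultimately have "\<bar>L\<^sup>2 * a - 2 * L * b\<bar> \<le> C * L\<^sup>2 + 2 * C * L"
      by (simp add: mult_ac)
    then have "\<theta> * \<bar>L\<^sup>2 * a - 2 * L * b\<bar> \<le> \<theta> * (C * L\<^sup>2 + 2 * C * L)" using \<theta> by (intro mult_left_mono) simp_all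
    moreover have "\<theta> * (L\<^sup>2 * a - 2 * L * b + c) - \<theta> * c = \<theta> * (L\<^sup>2 * a - 2 * L * b)" by (simp add: algebra_simps)
    ultimately have 3: "\<bar>\<theta> * (L\<^sup>2 * a - 2 * L * b + c) - \<theta> * c\<bar> \<le> \<theta> * (C * L\<^sup>2 + 2 * C * L)"
      using \<theta> by (simp only: abs_mult abs_of_pos)
    have "\<bar>(\<Sum>i=1..n. ewens_p \<theta> i * (ln (real n / real i))\<^sup>2) - (\<Sum>i=1..n. \<theta> / real i * (ln (real n / real i))\<^sup>2)\<bar> \<le> D * L\<^sup>2 * 2"
      unfolding D_def using L ln_ratio_bounds(1,2) by (intro sum_ewens_p_approx[OF \<theta>]) (simp_all add: L_def power_mono)
    then show ?thesis unfolding 1 2 f_def L_def[symmetric] using 3 by linarith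
  qed
  have l1: "(\<lambda>n. (ln (real n))\<^sup>2 / (\<theta> / 6 * (ln (real n)) ^ 3)) \<longlonglongrightarrow> 0"
    and l2: "(\<lambda>n. ln (real n) / (\<theta> / 6 * (ln (real n)) ^ 3)) \<longlonglongrightarrow> 0" using \<theta> by real_asymp+
  have "(\<lambda>n. (D * 2 + \<theta> * C) * ((ln (real n))\<^sup>2 / (\<theta> / 6 * (ln (real n)) ^ 3))
      + \<theta> * 2 * C * (ln (real n) / (\<theta> / 6 * (ln (real n)) ^ 3))) \<longlonglongrightarrow> (D * 2 + \<theta> * C) * 0 + \<theta> * 2 * C * 0"
    by (intro tendsto_add tendsto_mult tendsto_const l1 l2)
  moreover have "(D * 2 + \<theta> * C) * (L\<^sup>2 / r) + \<theta> * 2 * C * (L / r) = f L / r" for L r :: real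
    unfolding f_def by (simp add: add_divide_distrib distrib_left distrib_right mult_ac)
  ultimately have "(\<lambda>n. f (ln (real n)) / (\<theta> / 6 * (ln (real n)) ^ 3)) \<longlonglongrightarrow> 0" by (simp only: mult_zero_right add_0_right)
  from tendsto_div_ewens_sigma_squared[OF \<theta> bound this]
  have "(\<lambda>n. ((\<Sum>i=1..n. ewens_p \<theta> i * (ln (real n / real i))\<^sup>2) - (ewens_sigma \<theta> n)\<^sup>2) / (ewens_sigma \<theta> n)\<^sup>2) \<longlonglongrightarrow> 0" .
  from tendsto_add[OF this tendsto_const[of 1]]
  have "(\<lambda>n. ((\<Sum>i=1..n. ewens_p \<theta> i * (ln (real n / real i))\<^sup>2) - (ewens_sigma \<theta> n)\<^sup>2) / (ewens_sigma \<theta> n)\<^sup>2 + 1) \<longlonglongrightarrow> 1"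
    by simp
  then show ?thesis
  proof (rule Lim_transform_eventually)
    show "\<forall>\<^sub>F n in sequentially. ((\<Sum>i=1..n. ewens_p \<theta> i * (ln (real n / real i))\<^sup>2) - (ewens_sigma \<theta> n)\<^sup>2) / (ewens_sigma \<theta> n)\<^sup>2 + 1 =
        (\<Sum>i=1..n. ewens_p \<theta> i * (ln (real n / real i))\<^sup>2) / (ewens_sigma \<theta> n)\<^sup>2"
      using ewens_sigma_lower[OF \<theta>]
    proof eventually_elim
      case (elim n)
      then have "0 < sqrt (\<theta> / 6 * (ln (real n)) ^ 3)" by simp
      then have "ewens_sigma \<theta> n \<noteq> 0" using elim by linarith
      then show ?case by (simp add: diff_divide_distrib)
    qed
  qed
qed

text \<open>The mean number of cycles is of order at most \<open>ln n\<close>, so the deviation is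
  of order at most ln n ln (ln n), while the standard deviation is at least of order
  \<open>(ln n) powr (3/2)\<close>.\<close>

lemma ewens_deviation_tendsto:
  assumes \<theta>: "\<theta> > 0"
  shows "(\<lambda>n. ewens_exp \<theta> n (\<lambda>\<sigma>. \<bar>ln (real (invol n \<sigma>)) - (\<Sum>i\<in>cycle_mins n \<sigma>. ln (real n / real i))\<bar>)
    / ewens_sigma \<theta> n) \<longlonglongrightarrow> 0"
proof -
  obtain C where C: "C > 0"
    and h0: "\<And>n. \<bar>(\<Sum>k=1..n. 1 / real k) - ln (real n)\<bar> \<le> C"
    using log_power_sums by metis
  define A where "A = max 1 \<theta>"
  have A: "A > 0" by (simp add: A_def)
  \<comment> \<open>\<open>B (ln n)\<close> is an explicit upper bound for the mean number of
    cycles, obtained from \<open>ewens_p \<theta> i \<le> A / i\<close>.\<close>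
  define B where "B L = A * (L + C)" for L
  define E where "E = 3 * (1 + \<theta>) + 2 * exp 2"
  have E: "E > 0" using \<theta> by (simp add: E_def add_pos_pos)
  have "\<bar>ewens_exp \<theta> n (\<lambda>\<sigma>. \<bar>ln (real (invol n \<sigma>)) - (\<Sum>i\<in>cycle_mins n \<sigma>. ln (real n / real i))\<bar>)\<bar>
      \<le> E * B (ln (real n)) + B (ln (real n)) * ln (B (ln (real n)))" if n: "n \<ge> 1" for n
  proof -
    define m where "m = ewens_lambda \<theta> n"
    have m1: "m \<ge> 1" unfolding m_def by (rule ewens_lambda_ge_1[OF \<theta> n])
    have "m \<le> (\<Sum>i=1..n. A * (1 / real i))"
      unfolding m_def ewens_lambda_def A_def using ewens_p_bounds(1)[OF \<theta>] by (intro sum_mono) simp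
    also have "\<dots> \<le> B (ln (real n))"
      unfolding B_def sum_distrib_left[symmetric] using A h0[of n] by (intro mult_left_mono) auto
    finally have mB: "m \<le> B (ln (real n))" .
    have "0 \<le> ewens_exp \<theta> n (\<lambda>\<sigma>. \<bar>ln (real (invol n \<sigma>)) - (\<Sum>i\<in>cycle_mins n \<sigma>. ln (real n / real i))\<bar>)"
      unfolding ewens_exp_def using ewens_weight_nonneg[OF \<theta>] by (intro sum_nonneg mult_nonneg_nonneg) simp_all
    moreover have "ewens_exp \<theta> n (\<lambda>\<sigma>. \<bar>ln (real (invol n \<sigma>)) - (\<Sum>i\<in>cycle_mins n \<sigma>. ln (real n / real i))\<bar>)
        \<le> E * m + m * ln m"
      using ewens_exp_invol_deviation[OF \<theta> n] unfolding m_def E_def by (simp add: algebra_simps)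
    moreover have "E * m \<le> E * B (ln (real n))" using mB E by (intro mult_left_mono) simp_all
    moreover have "m * ln m \<le> B (ln (real n)) * ln (B (ln (real n)))"
      using mB m1 by (intro mult_mono) simp_all
    ultimately show ?thesis by linarith
  qed
  then have "\<forall>\<^sub>F n in sequentially. \<bar>ewens_exp \<theta> n (\<lambda>\<sigma>. \<bar>ln (real (invol n \<sigma>)) -
      (\<Sum>i\<in>cycle_mins n \<sigma>. ln (real n / real i))\<bar>)\<bar> \<le> E * B (ln (real n)) + B (ln (real n)) * ln (B (ln (real n)))"
    by (intro eventually_mono[OF eventually_ge_at_top[of 1]])
  then show ?thesis
  proof (rule tendsto_div_ewens_sigma[OF \<theta>])
    show "(\<lambda>n. (E * B (ln (real n)) + B (ln (real n)) * ln (B (ln (real n)))) / sqrt (\<theta> / 6 * (ln (real n)) ^ 3)) \<longlonglongrightarrow> 0"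
      unfolding B_def using \<theta> A C E by real_asymp
  qed
qed

section \<open>Characteristic functions and the limit theorem\<close>

lemma norm_iexp_diff_le: "cmod (iexp a - iexp b) \<le> \<bar>a - b\<bar>"
proof -
  have "iexp a - iexp b = iexp b * (iexp (a - b) - 1)"
    by (simp add: right_diff_distrib exp_add[symmetric])
  then have "cmod (iexp a - iexp b) = cmod (iexp (a - b) - 1)"
    by (simp add: norm_mult)
  also have "\<dots> \<le> \<bar>a - b\<bar>" using iexp_approx1[of "a - b" 0] by simp
  finally show ?thesis .
qed

text \<open>Here \<open>1 + w\<close> is the characteristic function of a Bernoulli variable and
  \<open>exp w\<close> that of a Poisson variable with the same mean. Their difference is of second
  order in \<open>w\<close>, and \<open>exp 2\<close> comes from
  \<open>\<bar>Re w\<bar> \<le> 2\<close>. Working with \<open>exp w\<close> avoids complex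
  logarithms.\<close>

lemma bernoulli_char_approx:
  fixes p u :: real
  assumes p: "0 \<le> p" "p \<le> 1"
  defines "w \<equiv> of_real p * (iexp u - 1)"
  shows "cmod (1 + w) \<le> 1" "cmod (exp w) \<le> 1" "cmod (1 + w - exp w) \<le> exp 2 * (p\<^sup>2 * u\<^sup>2)"
proof -
  have "1 + w = of_real (1 - p) + of_real p * iexp u" by (simp add: w_def algebra_simps)
  then have "cmod (1 + w) \<le> cmod (of_real (1 - p)) + cmod (of_real p * iexp u)"
    by (metis norm_triangle_ineq)
  also have "\<dots> = 1" using p by (simp only: norm_mult norm_of_real norm_exp_i_times abs_of_nonneg)
  finally show "cmod (1 + w) \<le> 1" .
  have Re: "Re w = p * (cos u - 1)" by (simp add: w_def Re_exp)
  then have "Re w \<le> 0" using p by (simp add: mult_nonneg_nonpos)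
  then show "cmod (exp w) \<le> 1" by simp
  have "\<bar>cos u - 1\<bar> \<le> 2" using cos_ge_minus_one[of u] cos_le_one[of u] by linarith
  then have "\<bar>Re w\<bar> \<le> 1 * 2" unfolding Re abs_mult using p by (intro mult_mono) simp_all
  then have e: "exp \<bar>Re w\<bar> \<le> exp 2" by simp
  have "cmod (iexp u - 1) \<le> \<bar>u\<bar>" using norm_iexp_diff_le[of u 0] by simp
  then have "cmod w \<le> p * \<bar>u\<bar>" unfolding w_def norm_mult using p by (simp add: mult_left_mono)
  then have "(cmod w)\<^sup>2 \<le> (p * \<bar>u\<bar>)\<^sup>2" by (intro power_mono) simp_all
  then have q: "(cmod w)\<^sup>2 \<le> p\<^sup>2 * u\<^sup>2" by (simp add: power_mult_distrib)
  have "cmod (1 + w - exp w) = cmod (exp w - (\<Sum>k\<le>1. w ^ k / fact k))"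
    by (simp add: norm_minus_commute)
  also have "\<dots> \<le> exp \<bar>Re w\<bar> * (cmod w)\<^sup>2"
    using Taylor_exp[of w 1] by (simp add: numeral_2_eq_2)
  also have "\<dots> \<le> exp 2 * (p\<^sup>2 * u\<^sup>2)" using e q by (intro mult_mono) simp_all
  finally show "cmod (1 + w - exp w) \<le> exp 2 * (p\<^sup>2 * u\<^sup>2)" .
qed

lemma iexp_quadratic_approx:
  "cmod (iexp u - 1 - (\<i> * of_real u - of_real (u\<^sup>2) / 2)) \<le> \<bar>u\<bar> ^ 3 / 6"
proof -
  have "(\<Sum>k\<le>2. (\<i> * complex_of_real u) ^ k / fact k) = 1 + (\<i> * of_real u - of_real (u\<^sup>2) / 2)"
    by (simp add: numeral_2_eq_2 power_mult_distrib)
  then show ?thesis using iexp_approx1[of u 2] by (simp add: diff_diff_eq numeral_3_eq_3 fact_numeral)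
qed

text \<open>By independence the characteristic function is a product. Its factors are replaced by
  exponentials, and the total exponent is then expanded to second order, where the centred mean
  disappears and the second moment yields \<open>- t * t / 2\<close>.\<close>

lemma ewens_char_cycles_tendsto:
  fixes t :: real
  assumes \<theta>: "\<theta> > 0"
  shows "(\<lambda>n. \<Sum>\<sigma> | \<sigma> permutes {1..n}. of_real (ewens_weight \<theta> n \<sigma>) *
      iexp (t * (((\<Sum>i\<in>cycle_mins n \<sigma>. ln (real n / real i)) - ewens_mu \<theta> n) / ewens_sigma \<theta> n)))
    \<longlonglongrightarrow> of_real (exp (- (t\<^sup>2) / 2))"
proof -
  define s where "s = ewens_sigma \<theta>"
  define g where "g n i = ln (real n / real i)" for n i :: nat
  define u where "u n i = t * g n i / s n" for n i
  define w where "w n i = of_real (ewens_p \<theta> i) * (iexp (u n i) - 1)" for n i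
  define r where "r n = t * ewens_mu \<theta> n / s n" for n
  define X where "X n = - (\<i> * of_real (r n)) + (\<Sum>i=1..n. w n i)" for n
  define V where "V n = (\<Sum>i=1..n. ewens_p \<theta> i * (g n i)\<^sup>2) / (s n)\<^sup>2" for n
  have s: "s n \<ge> 0" for n
    unfolding s_def ewens_sigma_def using \<theta> by (intro real_sqrt_ge_zero sum_nonneg) simp
  have p: "0 \<le> ewens_p \<theta> i" "ewens_p \<theta> i \<le> 1" for i
    using ewens_p_pos[OF \<theta>, of i] ewens_p_le_1[OF \<theta>, of i] by simp_all
  have u: "\<bar>u n i\<bar> \<le> \<bar>t\<bar> * (ln (real n) / s n)" if "i \<in> {1..n}" for n i
  proof -
    have "\<bar>u n i\<bar> = \<bar>t\<bar> * (g n i / s n)"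
      using ln_ratio_bounds(1)[of i n] that s[of n] by (simp add: u_def abs_mult g_def)
    also have "\<dots> \<le> \<bar>t\<bar> * (ln (real n) / s n)"
      using ln_ratio_bounds(2)[of i n] that s[of n]
      by (intro mult_left_mono divide_right_mono) (simp_all add: g_def)
    finally show ?thesis .
  qed
  have lim_L: "(\<lambda>n. ln (real n) / s n) \<longlonglongrightarrow> 0"
    unfolding s_def by (rule ln_div_ewens_sigma_tendsto[OF \<theta>])
  have lim_V: "V \<longlonglongrightarrow> 1"
    unfolding V_def g_def s_def by (rule ewens_variance_tendsto[OF \<theta>])
  have char_eq: "(\<Sum>\<sigma> | \<sigma> permutes {1..n}. of_real (ewens_weight \<theta> n \<sigma>) *
      iexp (t * (((\<Sum>i\<in>cycle_mins n \<sigma>. g n i) - ewens_mu \<theta> n) / s n))) =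
      iexp (- r n) * (\<Prod>i=1..n. 1 + w n i)" for n
  proof -
    have eq: "iexp (t * (((\<Sum>i\<in>M. g n i) - ewens_mu \<theta> n) / s n)) = iexp (- r n) * (\<Prod>i\<in>M. iexp (u n i))"
      if "finite M" for M
    proof -
      have "t * (((\<Sum>i\<in>M. g n i) - ewens_mu \<theta> n) / s n) = - r n + (\<Sum>i\<in>M. u n i)"
        by (simp add: r_def u_def sum_divide_distrib[symmetric] sum_distrib_left[symmetric]
            diff_divide_distrib right_diff_distrib)
      then show ?thesis using that
        by (simp add: exp_add[symmetric] exp_sum[symmetric] distrib_left right_diff_distrib sum_distrib_left)
    qed
    have "(\<Sum>\<sigma> | \<sigma> permutes {1..n}. of_real (ewens_weight \<theta> n \<sigma>) *
        (iexp (- r n) * (\<Prod>i\<in>cycle_mins n \<sigma>. iexp (u n i)))) =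
        iexp (- r n) * (\<Sum>\<sigma> | \<sigma> permutes {1..n}. of_real (ewens_weight \<theta> n \<sigma>) *
          (\<Prod>i\<in>cycle_mins n \<sigma>. iexp (u n i)))"
      unfolding sum_distrib_left by (intro sum.cong refl mult.left_commute)
    then show ?thesis
      by (simp only: eq[OF finite_cycle_mins] w_def ewens_generating_function[OF \<theta>])
  qed
  \<comment> \<open>The error is bounded by the sum of squared probabilities, which stays bounded,
    times the square of the uniform bound for \<open>u\<close>, which tends to 0.\<close>
  have prod_approx: "(\<lambda>n. iexp (- r n) * (\<Prod>i=1..n. 1 + w n i) - exp (X n)) \<longlonglongrightarrow> 0"
  proof (rule Lim_null_comparison)
    show "\<forall>\<^sub>F n in sequentially. cmod (iexp (- r n) * (\<Prod>i=1..n. 1 + w n i) - exp (X n)) \<le>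
        exp 2 * (\<bar>t\<bar> * (ln (real n) / s n))\<^sup>2 * ((max 1 \<theta>)\<^sup>2 * 2)"
    proof (rule always_eventually, rule allI)
      fix n
      have "exp (X n) = iexp (- r n) * (\<Prod>i=1..n. exp (w n i))"
        by (simp add: X_def exp_sum exp_diff exp_minus divide_inverse mult.commute)
      then have "cmod (iexp (- r n) * (\<Prod>i=1..n. 1 + w n i) - exp (X n)) =
          cmod ((\<Prod>i=1..n. 1 + w n i) - (\<Prod>i=1..n. exp (w n i)))"
        by (simp add: right_diff_distrib[symmetric] norm_mult)
      \<comment> \<open>All factors lie in the closed unit disc, so the difference of the products
        is at most the sum of the differences of the factors.\<close>
      also have "\<dots> \<le> (\<Sum>i=1..n. cmod (1 + w n i - exp (w n i)))"
        unfolding w_def by (intro norm_prod_diff bernoulli_char_approx p)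
      also have "\<dots> \<le> (\<Sum>i=1..n. exp 2 * (\<bar>t\<bar> * (ln (real n) / s n))\<^sup>2 * (ewens_p \<theta> i)\<^sup>2)"
      proof (rule sum_mono)
        fix i assume i: "i \<in> {1..n}"
        have "(u n i)\<^sup>2 \<le> (\<bar>t\<bar> * (ln (real n) / s n))\<^sup>2"
          using u[OF i] by (metis abs_ge_zero power2_abs power_mono)
        then have "(ewens_p \<theta> i)\<^sup>2 * (u n i)\<^sup>2 \<le> (ewens_p \<theta> i)\<^sup>2 * (\<bar>t\<bar> * (ln (real n) / s n))\<^sup>2"
          by (rule mult_left_mono) simp
        then have "exp 2 * ((ewens_p \<theta> i)\<^sup>2 * (u n i)\<^sup>2) \<le> exp 2 * ((ewens_p \<theta> i)\<^sup>2 * (\<bar>t\<bar> * (ln (real n) / s n))\<^sup>2)"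
          by (rule mult_left_mono) simp
        from order_trans[OF bernoulli_char_approx(3)[OF p, of i "u n i"] this]
        show "cmod (1 + w n i - exp (w n i)) \<le> exp 2 * (\<bar>t\<bar> * (ln (real n) / s n))\<^sup>2 * (ewens_p \<theta> i)\<^sup>2"
          unfolding w_def by (simp only: mult_ac)
      qed
      also have "\<dots> \<le> exp 2 * (\<bar>t\<bar> * (ln (real n) / s n))\<^sup>2 * ((max 1 \<theta>)\<^sup>2 * 2)"
        unfolding sum_distrib_left[symmetric] by (intro mult_left_mono sum_ewens_p_squared_le[OF \<theta>]) simp
      finally show "cmod (iexp (- r n) * (\<Prod>i=1..n. 1 + w n i) - exp (X n)) \<le>
        exp 2 * (\<bar>t\<bar> * (ln (real n) / s n))\<^sup>2 * ((max 1 \<theta>)\<^sup>2 * 2)" .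
    qed
    have "(\<lambda>n. exp 2 * (\<bar>t\<bar> * (ln (real n) / s n))\<^sup>2 * ((max 1 \<theta>)\<^sup>2 * 2)) \<longlonglongrightarrow>
        exp 2 * (\<bar>t\<bar> * 0)\<^sup>2 * ((max 1 \<theta>)\<^sup>2 * 2)"
      by (intro tendsto_mult tendsto_power tendsto_const lim_L)
    then show "(\<lambda>n. exp 2 * (\<bar>t\<bar> * (ln (real n) / s n))\<^sup>2 * ((max 1 \<theta>)\<^sup>2 * 2)) \<longlonglongrightarrow> 0"
      by simp
  qed
  \<comment> \<open>\<open>Y\<close> is the second-order Taylor polynomial of the exponent
    \<open>X\<close>, with the centring term merged into the mean.\<close>
  define Y where "Y n = \<i> * of_real (t * (((\<Sum>i=1..n. ewens_p \<theta> i * g n i) - ewens_mu \<theta> n) / s n)) -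
    of_real (t\<^sup>2 / 2 * V n)" for n
  have "(\<lambda>n. X n - Y n) \<longlonglongrightarrow> 0"
  proof (rule Lim_null_comparison)
    show "\<forall>\<^sub>F n in sequentially. cmod (X n - Y n) \<le> \<bar>t\<bar> * (ln (real n) / s n) / 6 * (t\<^sup>2 * V n)"
    proof (rule always_eventually, rule allI)
      fix n
      have pu: "(\<Sum>i=1..n. ewens_p \<theta> i * u n i) = t * ((\<Sum>i=1..n. ewens_p \<theta> i * g n i) / s n)"
        by (simp add: u_def sum_distrib_left sum_divide_distrib mult_ac)
      have pu2: "(\<Sum>i=1..n. ewens_p \<theta> i * (u n i)\<^sup>2) = t\<^sup>2 * V n"
        by (simp add: u_def V_def sum_distrib_left sum_divide_distrib power_divide power_mult_distrib mult_ac)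
      have "Y n = - (\<i> * of_real (r n)) + (\<i> * of_real (\<Sum>i=1..n. ewens_p \<theta> i * u n i) -
          of_real (\<Sum>i=1..n. ewens_p \<theta> i * (u n i)\<^sup>2) / 2)"
        unfolding pu pu2 Y_def r_def by (simp add: diff_divide_distrib right_diff_distrib)
      also have "\<i> * of_real (\<Sum>i=1..n. ewens_p \<theta> i * u n i) -
          of_real (\<Sum>i=1..n. ewens_p \<theta> i * (u n i)\<^sup>2) / 2 =
          (\<Sum>i=1..n. of_real (ewens_p \<theta> i) * (\<i> * of_real (u n i) - of_real ((u n i)\<^sup>2) / 2))"
        by (simp add: sum_distrib_left sum_divide_distrib sum_subtractf right_diff_distrib mult_ac)
      finally have "X n - Y n = (\<Sum>i=1..n. of_real (ewens_p \<theta> i) *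
          (iexp (u n i) - 1 - (\<i> * of_real (u n i) - of_real ((u n i)\<^sup>2) / 2)))"
        by (simp add: X_def w_def sum_subtractf[symmetric] right_diff_distrib[symmetric])
      then have "cmod (X n - Y n) \<le> (\<Sum>i=1..n. cmod (of_real (ewens_p \<theta> i) *
          (iexp (u n i) - 1 - (\<i> * of_real (u n i) - of_real ((u n i)\<^sup>2) / 2))))"
        by (simp only: norm_sum)
      \<comment> \<open>One factor of the cubic remainder is bounded uniformly in \<open>i\<close>;
        the remaining squares sum to \<open>t * t * V n\<close>.\<close>
      also have "\<dots> \<le> (\<Sum>i=1..n. \<bar>t\<bar> * (ln (real n) / s n) / 6 * (ewens_p \<theta> i * (u n i)\<^sup>2))"
      proof (rule sum_mono)
        fix i assume i: "i \<in> {1..n}"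
        have "\<bar>u n i\<bar> ^ 3 / 6 = \<bar>u n i\<bar> / 6 * (u n i)\<^sup>2"
          by (simp add: power3_eq_cube power2_eq_square)
        also have "\<dots> \<le> \<bar>t\<bar> * (ln (real n) / s n) / 6 * (u n i)\<^sup>2"
          using u[OF i] by (intro mult_right_mono divide_right_mono) simp_all
        finally have "cmod (iexp (u n i) - 1 - (\<i> * of_real (u n i) - of_real ((u n i)\<^sup>2) / 2))
            \<le> \<bar>t\<bar> * (ln (real n) / s n) / 6 * (u n i)\<^sup>2"
          using iexp_quadratic_approx[of "u n i"] by (rule order_trans[rotated])
        then have "ewens_p \<theta> i * cmod (iexp (u n i) - 1 - (\<i> * of_real (u n i) - of_real ((u n i)\<^sup>2) / 2))
            \<le> ewens_p \<theta> i * (\<bar>t\<bar> * (ln (real n) / s n) / 6 * (u n i)\<^sup>2)"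
          using p by (intro mult_left_mono)
        then show "cmod (of_real (ewens_p \<theta> i) * (iexp (u n i) - 1 - (\<i> * of_real (u n i) - of_real ((u n i)\<^sup>2) / 2)))
            \<le> \<bar>t\<bar> * (ln (real n) / s n) / 6 * (ewens_p \<theta> i * (u n i)\<^sup>2)"
          using p unfolding norm_mult norm_of_real abs_of_nonneg[OF p(1)] by (simp only: mult_ac)
      qed
      also have "\<dots> = \<bar>t\<bar> * (ln (real n) / s n) / 6 * (t\<^sup>2 * V n)"
        unfolding sum_distrib_left[symmetric] pu2 ..
      finally show "cmod (X n - Y n) \<le> \<bar>t\<bar> * (ln (real n) / s n) / 6 * (t\<^sup>2 * V n)" .
    qed
    have "(\<lambda>n. \<bar>t\<bar> * (ln (real n) / s n) / 6 * (t\<^sup>2 * V n)) \<longlonglongrightarrow> \<bar>t\<bar> * 0 / 6 * (t\<^sup>2 * 1)"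
      by (intro tendsto_mult tendsto_divide tendsto_const lim_L lim_V) simp
    then show "(\<lambda>n. \<bar>t\<bar> * (ln (real n) / s n) / 6 * (t\<^sup>2 * V n)) \<longlonglongrightarrow> 0" by simp
  qed
  moreover have "Y \<longlonglongrightarrow> \<i> * of_real (t * 0) - of_real (t\<^sup>2 / 2 * 1)"
    unfolding Y_def g_def s_def
    by (intro tendsto_diff tendsto_mult tendsto_of_real tendsto_const ewens_mean_tendsto[OF \<theta>] lim_V)
  ultimately have "(\<lambda>n. (X n - Y n) + Y n) \<longlonglongrightarrow> 0 + (\<i> * of_real (t * 0) - of_real (t\<^sup>2 / 2 * 1))"
    by (rule tendsto_add)
  then have "(\<lambda>n. exp (X n)) \<longlonglongrightarrow> exp (0 + (\<i> * of_real (t * 0) - of_real (t\<^sup>2 / 2 * 1)))"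
    by (intro tendsto_exp) simp
  from tendsto_add[OF prod_approx this]
  have "(\<lambda>n. iexp (- r n) * (\<Prod>i=1..n. 1 + w n i)) \<longlonglongrightarrow> exp (of_real (- (t\<^sup>2) / 2))"
    by simp
  then show ?thesis unfolding char_eq[symmetric] g_def s_def exp_of_real .
qed

text \<open>The map \<open>iexp\<close> is 1-Lipschitz, so the two characteristic functions differ
  by at most \<open>\<bar>t\<bar>\<close> times the mean deviation over the standard deviation.
  Convergence in mean is thus all that is needed to pass from the Bernoulli sum to
  \<open>invol\<close>.\<close>

lemma ewens_char_invol_tendsto:
  fixes t :: real
  assumes \<theta>: "\<theta> > 0"
  shows "(\<lambda>n. \<Sum>\<sigma> | \<sigma> permutes {1..n}. of_real (ewens_weight \<theta> n \<sigma>) *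
      iexp (t * ((ln (real (invol n \<sigma>)) - ewens_mu \<theta> n) / ewens_sigma \<theta> n)))
    \<longlonglongrightarrow> of_real (exp (- (t\<^sup>2) / 2))"
proof -
  define s where "s = ewens_sigma \<theta>"
  define S where "S n \<sigma> = (\<Sum>i\<in>cycle_mins n \<sigma>. ln (real n / real i))" for n \<sigma>
  define W where "W n \<sigma> = ln (real (invol n \<sigma>))" for n \<sigma>
  define \<phi> where "\<phi> n = (\<Sum>\<sigma> | \<sigma> permutes {1..n}. of_real (ewens_weight \<theta> n \<sigma>) *
      iexp (t * ((W n \<sigma> - ewens_mu \<theta> n) / s n)))" for n
  define \<psi> where "\<psi> n = (\<Sum>\<sigma> | \<sigma> permutes {1..n}. of_real (ewens_weight \<theta> n \<sigma>) *
      iexp (t * ((S n \<sigma> - ewens_mu \<theta> n) / s n)))" for n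
  have s: "s n \<ge> 0" for n
    unfolding s_def ewens_sigma_def using \<theta> by (intro real_sqrt_ge_zero sum_nonneg) simp
  have "(\<lambda>n. \<phi> n - \<psi> n) \<longlonglongrightarrow> 0"
  proof (rule Lim_null_comparison)
    show "\<forall>\<^sub>F n in sequentially. cmod (\<phi> n - \<psi> n) \<le> \<bar>t\<bar> * (ewens_exp \<theta> n (\<lambda>\<sigma>. \<bar>W n \<sigma> - S n \<sigma>\<bar>) / s n)"
    proof (rule always_eventually, rule allI)
      fix n
      have "\<phi> n - \<psi> n = (\<Sum>\<sigma> | \<sigma> permutes {1..n}. of_real (ewens_weight \<theta> n \<sigma>) *
          (iexp (t * ((W n \<sigma> - ewens_mu \<theta> n) / s n)) - iexp (t * ((S n \<sigma> - ewens_mu \<theta> n) / s n))))"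
        by (simp add: \<phi>_def \<psi>_def sum_subtractf right_diff_distrib)
      then have "cmod (\<phi> n - \<psi> n) \<le> (\<Sum>\<sigma> | \<sigma> permutes {1..n}. cmod (of_real (ewens_weight \<theta> n \<sigma>) *
          (iexp (t * ((W n \<sigma> - ewens_mu \<theta> n) / s n)) - iexp (t * ((S n \<sigma> - ewens_mu \<theta> n) / s n)))))"
        by (simp only: norm_sum)
      also have "\<dots> \<le> (\<Sum>\<sigma> | \<sigma> permutes {1..n}. \<bar>t\<bar> / s n * (ewens_weight \<theta> n \<sigma> * \<bar>W n \<sigma> - S n \<sigma>\<bar>))"
      proof (rule sum_mono)
        fix \<sigma>
        have "t * ((W n \<sigma> - ewens_mu \<theta> n) / s n) - t * ((S n \<sigma> - ewens_mu \<theta> n) / s n) =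
            t / s n * (W n \<sigma> - S n \<sigma>)"
          by (simp add: diff_divide_distrib right_diff_distrib)
        then have "\<bar>t * ((W n \<sigma> - ewens_mu \<theta> n) / s n) - t * ((S n \<sigma> - ewens_mu \<theta> n) / s n)\<bar> =
            \<bar>t\<bar> / s n * \<bar>W n \<sigma> - S n \<sigma>\<bar>"
          using s[of n] by (simp only: abs_mult abs_divide abs_of_nonneg)
        then have "cmod (iexp (t * ((W n \<sigma> - ewens_mu \<theta> n) / s n)) - iexp (t * ((S n \<sigma> - ewens_mu \<theta> n) / s n))) \<le>
            \<bar>t\<bar> / s n * \<bar>W n \<sigma> - S n \<sigma>\<bar>"
          using norm_iexp_diff_le by metis
        then have "ewens_weight \<theta> n \<sigma> * cmod (iexp (t * ((W n \<sigma> - ewens_mu \<theta> n) / s n)) -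
            iexp (t * ((S n \<sigma> - ewens_mu \<theta> n) / s n))) \<le> ewens_weight \<theta> n \<sigma> * (\<bar>t\<bar> / s n * \<bar>W n \<sigma> - S n \<sigma>\<bar>)"
          using ewens_weight_nonneg[OF \<theta>] by (intro mult_left_mono)
        then show "cmod (of_real (ewens_weight \<theta> n \<sigma>) *
          (iexp (t * ((W n \<sigma> - ewens_mu \<theta> n) / s n)) - iexp (t * ((S n \<sigma> - ewens_mu \<theta> n) / s n)))) \<le>
          \<bar>t\<bar> / s n * (ewens_weight \<theta> n \<sigma> * \<bar>W n \<sigma> - S n \<sigma>\<bar>)"
          unfolding norm_mult norm_of_real abs_of_nonneg[OF ewens_weight_nonneg[OF \<theta>]]
          by (simp only: mult_ac)
      qed
      also have "\<dots> = \<bar>t\<bar> * (ewens_exp \<theta> n (\<lambda>\<sigma>. \<bar>W n \<sigma> - S n \<sigma>\<bar>) / s n)"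
        unfolding sum_distrib_left[symmetric] ewens_exp_def by simp
      finally show "cmod (\<phi> n - \<psi> n) \<le> \<bar>t\<bar> * (ewens_exp \<theta> n (\<lambda>\<sigma>. \<bar>W n \<sigma> - S n \<sigma>\<bar>) / s n)" .
    qed
    have "(\<lambda>n. \<bar>t\<bar> * (ewens_exp \<theta> n (\<lambda>\<sigma>. \<bar>W n \<sigma> - S n \<sigma>\<bar>) / s n)) \<longlonglongrightarrow> \<bar>t\<bar> * 0"
      unfolding W_def S_def s_def by (intro tendsto_mult tendsto_const ewens_deviation_tendsto[OF \<theta>])
    then show "(\<lambda>n. \<bar>t\<bar> * (ewens_exp \<theta> n (\<lambda>\<sigma>. \<bar>W n \<sigma> - S n \<sigma>\<bar>) / s n)) \<longlonglongrightarrow> 0" by simp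
  qed
  moreover have "\<psi> \<longlonglongrightarrow> of_real (exp (- (t\<^sup>2) / 2))"
    unfolding \<psi>_def S_def s_def by (rule ewens_char_cycles_tendsto[OF \<theta>])
  ultimately have "(\<lambda>n. (\<phi> n - \<psi> n) + \<psi> n) \<longlonglongrightarrow> 0 + of_real (exp (- (t\<^sup>2) / 2))"
    by (rule tendsto_add)
  then show ?thesis by (simp add: \<phi>_def W_def s_def)
qed

section \<open>Passage to probability distributions and Levy's theorem\<close>

definition ewens_measure :: "real \<Rightarrow> nat \<Rightarrow> (nat \<Rightarrow> nat) measure" where
  "ewens_measure \<theta> n = point_measure {\<sigma>. \<sigma> permutes {1..n}} (\<lambda>\<sigma>. ennreal (ewens_weight \<theta> n \<sigma>))"

lemma prob_space_ewens_measure: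
  assumes \<theta>: "\<theta> > 0"
  shows "prob_space (ewens_measure \<theta> n)"
  unfolding ewens_measure_def
proof (rule prob_space_point_measure)
  show "(\<Sum>\<sigma> | \<sigma> permutes {1..n}. ennreal (ewens_weight \<theta> n \<sigma>)) = 1"
    by (simp only: sum_ennreal ewens_weight_nonneg[OF \<theta>] sum_ewens_weight[OF \<theta>] ennreal_1)
qed simp_all

lemma measurable_ewens_measure [simp]: "f \<in> borel_measurable (ewens_measure \<theta> n)"
  by (simp add: ewens_measure_def)

lemma cdf_distr_ewens_measure:
  assumes \<theta>: "\<theta> > 0"
  shows "cdf (distr (ewens_measure \<theta> n) borel T) x = ewens_prob \<theta> n (\<lambda>\<sigma>. T \<sigma> \<le> x)"
proof -
  have "cdf (distr (ewens_measure \<theta> n) borel T) x =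
      measure (ewens_measure \<theta> n) (T -` {..x} \<inter> space (ewens_measure \<theta> n))"
    unfolding cdf_def by (rule measure_distr) simp_all
  also have "T -` {..x} \<inter> space (ewens_measure \<theta> n) = {\<sigma>. \<sigma> permutes {1..n} \<and> T \<sigma> \<le> x}"
    by (auto simp: ewens_measure_def space_point_measure)
  also have "measure (ewens_measure \<theta> n) {\<sigma>. \<sigma> permutes {1..n} \<and> T \<sigma> \<le> x} =
      (\<Sum>\<sigma>\<in>{\<sigma>. \<sigma> permutes {1..n} \<and> T \<sigma> \<le> x}. ewens_weight \<theta> n \<sigma>)"
    unfolding ewens_measure_def
    by (subst measure_point_measure_finite_if) (auto simp: ewens_weight_nonneg[OF \<theta>])
  also have "\<dots> = ewens_prob \<theta> n (\<lambda>\<sigma>. T \<sigma> \<le> x)"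
    by (simp add: ewens_prob_def ewens_weight_def sum_divide_distrib)
  finally show ?thesis .
qed

lemma char_distr_ewens_measure:
  assumes \<theta>: "\<theta> > 0"
  shows "char (distr (ewens_measure \<theta> n) borel T) t =
    (\<Sum>\<sigma> | \<sigma> permutes {1..n}. of_real (ewens_weight \<theta> n \<sigma>) * iexp (t * T \<sigma>))"
proof -
  have "char (distr (ewens_measure \<theta> n) borel T) t = (CLINT \<sigma>|ewens_measure \<theta> n. iexp (t * T \<sigma>))"
    unfolding char_def by (rule integral_distr) simp_all
  also have "\<dots> = (\<Sum>\<sigma> | \<sigma> permutes {1..n}. ewens_weight \<theta> n \<sigma> *\<^sub>R iexp (t * T \<sigma>))"
    unfolding ewens_measure_def
    by (rule lebesgue_integral_point_measure_finite) (simp_all add: ewens_weight_nonneg[OF \<theta>])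
  finally show ?thesis by (simp add: scaleR_conv_of_real)
qed

lemma cdf_std_normal_distribution: "cdf std_normal_distribution x = Phi x"
proof -
  interpret real_distribution std_normal_distribution by (rule real_dist_normal_dist)
  have "cdf std_normal_distribution x = (LINT y|std_normal_distribution. indicator {..x} y)"
    by (simp add: cdf_def)
  also have "\<dots> = (LINT y|lborel. std_normal_density y *\<^sub>R indicator {..x} y)"
    by (rule integral_density) simp_all
  also have "\<dots> = (LINT y|lborel. indicator {..x} y *\<^sub>R exp (- (y\<^sup>2) / 2) / sqrt (2 * pi))"
    by (intro Bochner_Integration.integral_cong refl) (simp add: std_normal_density_def)
  also have "\<dots> = Phi x"
    unfolding Phi_def set_lebesgue_integral_def by (rule integral_divide_zero)
  finally show ?thesis .
qed

text \<open>Weak convergence gives convergence of distribution functions only at continuity points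
  of the limit. A law with a density has no atoms, so every \<open>x\<close> is such a
  point.\<close>

lemma isCont_cdf_std_normal_distribution: "isCont (cdf std_normal_distribution) x"
proof -
  interpret real_distribution std_normal_distribution by (rule real_dist_normal_dist)
  have "{x} \<in> null_sets std_normal_distribution"
    using absolutely_continuousI_density[of std_normal_density lborel]
    unfolding absolutely_continuous_def by (rule subsetD) (simp_all add: null_sets_def)
  then show ?thesis by (simp add: isCont_cdf measure_eq_0_null_sets)
qed

theorem theorem4p4:
  fixes \<theta> x :: real
  assumes "\<theta> > 0"
  shows "(\<lambda>n. ewens_prob \<theta> n
            (\<lambda>\<sigma>. (ln (real (invol n \<sigma>)) - ewens_mu \<theta> n) / ewens_sigma \<theta> n \<le> x))
         \<longlonglongrightarrow> Phi x"
proof -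
  define T where "T n \<sigma> = (ln (real (invol n \<sigma>)) - ewens_mu \<theta> n) / ewens_sigma \<theta> n" for n \<sigma>
  have "weak_conv_m (\<lambda>n. distr (ewens_measure \<theta> n) borel (T n)) std_normal_distribution"
  proof (rule levy_continuity)
    fix n show "real_distribution (distr (ewens_measure \<theta> n) borel (T n))"
      by (rule prob_space.real_distribution_distr[OF prob_space_ewens_measure[OF assms]]) simp
  next
    fix t show "(\<lambda>n. char (distr (ewens_measure \<theta> n) borel (T n)) t) \<longlonglongrightarrow> char std_normal_distribution t"
      unfolding char_distr_ewens_measure[OF assms] char_std_normal_distribution T_def
      by (rule ewens_char_invol_tendsto[OF assms])
  qed (rule real_dist_normal_dist)
  then show ?thesis
    using isCont_cdf_std_normal_distribution[of x]
    by (simp add: weak_conv_m_def weak_conv_def cdf_distr_ewens_measure[OF assms] cdf_std_normal_distribution T_def)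
qed

end
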